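(* Let $b,c,d$ be $\mathcal{C}^\infty$ real-valued functions of $(x_3,x_4)$, and let $a(x_1,x_2,x_3,x_4)=x_1\,b(x_3,x_4)+x_2\,c(x_3,x_4)+d(x_3,x_4)$ on an open set $O\subset\mathbb{R}^4$. Let $g_a$ be the Walker metric on $O$ given by $$g_a = 2(dx_1\circ dx_3+dx_2\circ dx_4)+a\,dx_3\circ dx_3+a\,dx_4\circ dx_4 .$$ Then $g_a$ has parallel Ricci tensor if and only if there exist a function $k$ of $x_4$ alone and a function $l$ of $x_3$ alone such that \begin{align*} & b^2 = 2b_3+k(x_4),\qquad c^2=2c_4+l(x_3),\\ & 3cc_3-2c_{34}-2bc_4+b_4c = 0,\\ & 4cb_3 + bc_{3} - 2b_{34} - 2c_{33} - bb_4 = 0,\\ & cb_4 + 4bc_4 - 2b_{44} - 2c_{34} - cc_3 = 0,\\ & 3bb_4 - 2b_{34} + bc_3 - 2cb_3 = 0. \end{align*}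
   Context: Coordinates on $\mathbb{R}^4$ are $(x_1,x_2,x_3,x_4)$, with $\partial_i=\partial/\partial x_i$. Subscripts on functions denote partial derivatives: $b_i=\partial b/\partial x_i$, $b_{ij}=\partial^2 b/\partial x_i\partial x_j$, and similarly for $c$. The symbol $\circ$ is the symmetric product, so that the non-zero components of $g_a$ are $g_a(\partial_1,\partial_3)=g_a(\partial_2,\partial_4)=1$ (and the symmetric ones) and $g_a(\partial_3,\partial_3)=g_a(\partial_4,\partial_4)=a$; this is a pseudo-Riemannian metric of signature $(2,2)$. $\nabla$ is its Levi-Civita connection, the curvature is $\mathcal{R}(X,Y)=[\nabla_X,\nabla_Y]-\nabla_{[X,Y]}$, and $\rho$ is its Ricci tensor. The metric has parallel Ricci tensor (belongs to class $\mathcal{P}$) if $(\nabla_X\rho)(Y,Z)=0$ for all tangent vector fields $X,Y,Z$.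
   Formalization: The literal "only if" fails for disconnected O (c=d=0, b=0 and b=1 on two balls with overlapping x_4-ranges), so the equivalence is proved for connected open O, and for every open O with k and l chosen separately on each connected component. *)

theory Defs
  imports "HOL-Analysis.Analysis"
begin

section \<open>Smooth maps on open sets\<close>

text \<open>
  The derivatives are two-sided (\<open>at x\<close> rather than \<open>at x within S\<close>), so the definition below
  is meant for open \<open>S\<close>; what a function does outside \<open>S\<close> is irrelevant.
\<close>

fun Ck_on :: "nat \<Rightarrow> 'a::real_normed_vector set \<Rightarrow> ('a \<Rightarrow> 'b::real_normed_vector) \<Rightarrow> bool" where
  "Ck_on 0 S f \<longleftrightarrow> continuous_on S f"
| "Ck_on (Suc n) S f \<longleftrightarrow> (\<forall>x\<in>S. f differentiable (at x)) \<and>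
     (\<forall>v. Ck_on n S (\<lambda>x. frechet_derivative f (at x) v))"

definition smooth_on :: "'a::real_normed_vector set \<Rightarrow> ('a \<Rightarrow> 'b::real_normed_vector) \<Rightarrow> bool" where
  "smooth_on S f \<longleftrightarrow> (\<forall>n. Ck_on n S f)"

section \<open>Pseudo-Riemannian geometry on open subsets of \<open>\<real>\<^sup>n\<close>\<close>

text \<open>
  Tangent spaces are identified with \<open>\<real>\<^sup>n\<close>, vector fields with maps \<open>\<real>\<^sup>n \<Rightarrow> \<real>\<^sup>n\<close>, and a metric
  with the field of its Gram matrices with respect to the coordinate frame. A tensor of type
  \<open>(0,2)\<close> is an operation on pairs of vector fields.
\<close>

type_synonym 'n vfield = "real^'n \<Rightarrow> real^'n"
type_synonym 'n metric = "real^'n \<Rightarrow> real^'n^'n"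

definition pseudo_metric_on :: "(real^'n) set \<Rightarrow> 'n::finite metric \<Rightarrow> bool" where
  "pseudo_metric_on S g \<longleftrightarrow>
     (\<forall>i j. smooth_on S (\<lambda>x. g x $ i $ j)) \<and>
     (\<forall>x\<in>S. transpose (g x) = g x \<and> invertible (g x))"

definition metric_apply :: "'n::finite metric \<Rightarrow> 'n vfield \<Rightarrow> 'n vfield \<Rightarrow> real^'n \<Rightarrow> real" where
  "metric_apply g X Y x = X x \<bullet> (g x *v Y x)"

definition lie_bracket :: "'n::finite vfield \<Rightarrow> 'n vfield \<Rightarrow> 'n vfield" where
  "lie_bracket X Y x = frechet_derivative Y (at x) (X x) - frechet_derivative X (at x) (Y x)"

definition partial :: "'n::finite \<Rightarrow> (real^'n \<Rightarrow> real) \<Rightarrow> real^'n \<Rightarrow> real" where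
  "partial i f x = frechet_derivative f (at x) (axis i 1)"

text \<open>\<open>christoffel g k i j\<close> is the Christoffel symbol \<open>\<Gamma>\<close> with upper index \<open>k\<close> and lower indices \<open>i j\<close>.\<close>

definition christoffel :: "'n::finite metric \<Rightarrow> 'n \<Rightarrow> 'n \<Rightarrow> 'n \<Rightarrow> real^'n \<Rightarrow> real" where
  "christoffel g k i j x = 1/2 * (\<Sum>l\<in>UNIV. matrix_inv (g x) $ k $ l *
     (partial i (\<lambda>y. g y $ j $ l) x + partial j (\<lambda>y. g y $ i $ l) x - partial l (\<lambda>y. g y $ i $ j) x))"

text \<open>The Levi-Civita connection: see \<open>cov_deriv_torsion_free\<close> and \<open>cov_deriv_metric\<close> below.\<close>

definition cov_deriv :: "'n::finite metric \<Rightarrow> 'n vfield \<Rightarrow> 'n vfield \<Rightarrow> 'n vfield" where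
  "cov_deriv g X Y x = frechet_derivative Y (at x) (X x) +
     (\<chi> k. \<Sum>i\<in>UNIV. \<Sum>j\<in>UNIV. christoffel g k i j x * X x $ i * Y x $ j)"

definition curvature :: "'n::finite metric \<Rightarrow> 'n vfield \<Rightarrow> 'n vfield \<Rightarrow> 'n vfield \<Rightarrow> 'n vfield" where
  "curvature g X Y Z x =
     cov_deriv g X (cov_deriv g Y Z) x - cov_deriv g Y (cov_deriv g X Z) x
     - cov_deriv g (lie_bracket X Y) Z x"

text \<open>
  \<open>\<rho>(Y,Z)\<close> is the trace of \<open>X \<mapsto> R(X,Y)Z\<close>; a tangent vector \<open>v\<close> is extended to a constant field.
\<close>

definition ricci :: "'n::finite metric \<Rightarrow> 'n vfield \<Rightarrow> 'n vfield \<Rightarrow> real^'n \<Rightarrow> real" where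
  "ricci g Y Z x = trace (matrix (\<lambda>v. curvature g (\<lambda>_. v) Y Z x))"

definition cov_deriv_ricci ::
  "'n::finite metric \<Rightarrow> 'n vfield \<Rightarrow> 'n vfield \<Rightarrow> 'n vfield \<Rightarrow> real^'n \<Rightarrow> real" where
  "cov_deriv_ricci g X Y Z x =
     frechet_derivative (ricci g Y Z) (at x) (X x)
     - ricci g (cov_deriv g X Y) Z x - ricci g Y (cov_deriv g X Z) x"

definition parallel_ricci_on :: "(real^'n) set \<Rightarrow> 'n::finite metric \<Rightarrow> bool" where
  "parallel_ricci_on S g \<longleftrightarrow>
     (\<forall>X Y Z. smooth_on S X \<longrightarrow> smooth_on S Y \<longrightarrow> smooth_on S Z \<longrightarrow>
        (\<forall>x\<in>S. cov_deriv_ricci g X Y Z x = 0))"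

lemma partial_cong_open:
  assumes "open S" "x \<in> S" "\<And>y. y \<in> S \<Longrightarrow> f y = h y"
  shows "partial i f x = partial i h x"
proof -
  have "(f has_derivative F) (at x) \<longleftrightarrow> (h has_derivative F) (at x)" for F
    using has_derivative_transform_within_open[of f F x UNIV S h]
      has_derivative_transform_within_open[of h F x UNIV S f] assms by auto
  then show ?thesis by (simp add: partial_def frechet_derivative_def)
qed

lemma cov_deriv_torsion_free:
  assumes "open S" "pseudo_metric_on S g" "x \<in> S"
  shows "cov_deriv g X Y x - cov_deriv g Y X x = lie_bracket X Y x"
proof -
  have sym: "g y $ i $ j = g y $ j $ i" if "y \<in> S" for y i j
  proof -
    have "transpose (g y) $ j $ i = g y $ j $ i"
      using assms(2) that unfolding pseudo_metric_on_def by simp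
    then show ?thesis by (simp add: transpose_def)
  qed
  have psym: "partial l (\<lambda>y. g y $ i $ j) x = partial l (\<lambda>y. g y $ j $ i) x" for l i j
    by (rule partial_cong_open[OF assms(1,3)]) (rule sym)
  have csym: "christoffel g k i j x = christoffel g k j i x" for k i j
    unfolding christoffel_def psym[of _ i j] by (simp only: add.commute)
  have "(\<Sum>i\<in>UNIV. \<Sum>j\<in>UNIV. christoffel g k i j x * X x $ i * Y x $ j) =
     (\<Sum>i\<in>UNIV. \<Sum>j\<in>UNIV. christoffel g k i j x * Y x $ i * X x $ j)" for k
    by (subst sum.swap, intro sum.cong refl, subst csym) (simp add: mult.commute mult.left_commute)
  then show ?thesis by (simp add: cov_deriv_def lie_bracket_def)
qed

lemma frechet_derivative_component:
  fixes Y :: "'a::real_normed_vector \<Rightarrow> real^'n"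
  assumes "Y differentiable (at x)"
  shows "((\<lambda>y. Y y $ j) has_derivative (\<lambda>v. frechet_derivative Y (at x) v $ j)) (at x)"
  using assms frechet_derivative_works
  by (intro bounded_linear.has_derivative[OF bounded_linear_vec_nth]) blast

lemma cov_deriv_metric:
  assumes "open S" "pseudo_metric_on S g" "x \<in> S"
    and Y: "Y differentiable (at x)" and Z: "Z differentiable (at x)"
  shows "frechet_derivative (metric_apply g Y Z) (at x) (X x) =
    metric_apply g (cov_deriv g X Y) Z x + metric_apply g Y (cov_deriv g X Z) x"
proof -
  let ?dg = "\<lambda>i j. frechet_derivative (\<lambda>y. g y $ i $ j) (at x)"
  let ?dY = "frechet_derivative Y (at x)" and ?dZ = "frechet_derivative Z (at x)"
  define p where "p l i j = partial l (\<lambda>y. g y $ i $ j) x" for l i j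
  have sym': "g y $ i $ j = g y $ j $ i" if "y \<in> S" for y i j
  proof -
    have "transpose (g y) $ j $ i = g y $ j $ i"
      using assms(2) that unfolding pseudo_metric_on_def by simp
    then show ?thesis by (simp add: transpose_def)
  qed
  then have sym: "g x $ i $ j = g x $ j $ i" for i j using assms(3) by blast
  have psym: "p l i j = p l j i" for l i j
    unfolding p_def by (rule partial_cong_open[OF assms(1,3)]) (rule sym')
  have inv: "g x ** matrix_inv (g x) = mat 1"
    using assms(2,3) unfolding pseudo_metric_on_def invertible_def matrix_inv_def
    by (metis (mono_tags, lifting) someI_ex)
  have diff: "(\<lambda>y. g y $ i $ j) differentiable (at x)" for i j
  proof -
    have "Ck_on (Suc 0) S (\<lambda>y. g y $ i $ j)"
      using assms(2) unfolding pseudo_metric_on_def smooth_on_def by blast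
    then show ?thesis using assms(3) by simp
  qed
  have hg: "((\<lambda>y. g y $ i $ j) has_derivative ?dg i j) (at x)" for i j
    using diff frechet_derivative_works by blast
  have dg: "?dg i j v = (\<Sum>l\<in>UNIV. v $ l * p l i j)" for i j v
  proof -
    have lin: "linear (?dg i j)" using diff linear_frechet_derivative by blast
    have "(\<Sum>l\<in>UNIV. v $ l *\<^sub>R axis l 1) = v"
      using basis_expansion[of v] by (simp add: scalar_mult_eq_scaleR)
    then have "?dg i j v = ?dg i j (\<Sum>l\<in>UNIV. v $ l *\<^sub>R axis l 1)"
      by (rule arg_cong[OF HOL.sym])
    also have "\<dots> = (\<Sum>l\<in>UNIV. v $ l * p l i j)"
      by (simp add: linear_sum[OF lin] linear_cmul[OF lin] p_def partial_def)
    finally show ?thesis .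
  qed
  have low: "(\<Sum>k\<in>UNIV. g x $ m $ k * christoffel g k i j x) = 1/2 * (p i j m + p j i m - p m i j)" for m i j
  proof -
    have delta: "(\<Sum>k\<in>UNIV. g x $ m $ k * matrix_inv (g x) $ k $ l) = (if m = l then 1 else 0)" for l
      using arg_cong[OF inv, of "\<lambda>A. A $ m $ l"] by (simp add: matrix_matrix_mult_def mat_def)
    have "(\<Sum>k\<in>UNIV. g x $ m $ k * christoffel g k i j x)
      = 1/2 * (\<Sum>l\<in>UNIV. (\<Sum>k\<in>UNIV. g x $ m $ k * matrix_inv (g x) $ k $ l) * (p i j l + p j i l - p l i j))"
      unfolding christoffel_def p_def[symmetric] sum_distrib_left sum_distrib_right
      by (subst sum.swap) (simp add: mult.assoc mult.left_commute)
    then show ?thesis unfolding delta by (simp add: if_distrib[of "\<lambda>z. z * _"] cong: if_cong)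
  qed
  have lhs: "frechet_derivative (metric_apply g Y Z) (at x) (X x) =
    (\<Sum>i\<in>UNIV. \<Sum>j\<in>UNIV. g x $ i $ j * ?dY (X x) $ i * Z x $ j + g x $ i $ j * Y x $ i * ?dZ (X x) $ j
       + ?dg i j (X x) * Y x $ i * Z x $ j)"
  proof -
    have "metric_apply g Y Z = (\<lambda>y. \<Sum>i\<in>UNIV. \<Sum>j\<in>UNIV. g y $ i $ j * Y y $ i * Z y $ j)"
      by (simp add: fun_eq_iff metric_apply_def inner_vec_def matrix_vector_mult_def
          sum_distrib_left mult_ac)
    moreover have "((\<lambda>y. \<Sum>i\<in>UNIV. \<Sum>j\<in>UNIV. g y $ i $ j * Y y $ i * Z y $ j) has_derivative
      (\<lambda>v. \<Sum>i\<in>UNIV. \<Sum>j\<in>UNIV. g x $ i $ j * ?dY v $ i * Z x $ j + g x $ i $ j * Y x $ i * ?dZ v $ j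
       + ?dg i j v * Y x $ i * Z x $ j)) (at x)"
      by (intro has_derivative_sum has_derivative_eq_rhs[OF has_derivative_mult[OF has_derivative_mult[OF hg
            frechet_derivative_component[OF Y]] frechet_derivative_component[OF Z]]])
        (simp add: fun_eq_iff algebra_simps)
    ultimately show ?thesis by (simp add: frechet_derivative_at[symmetric])
  qed
  define GY where "GY k = (\<Sum>i\<in>UNIV. \<Sum>j\<in>UNIV. christoffel g k i j x * X x $ i * Y x $ j)" for k
  define GZ where "GZ k = (\<Sum>i\<in>UNIV. \<Sum>j\<in>UNIV. christoffel g k i j x * X x $ i * Z x $ j)" for k
  have cY: "cov_deriv g X Y x $ k = ?dY (X x) $ k + GY k" for k
    by (simp add: cov_deriv_def GY_def)
  have cZ: "cov_deriv g X Z x $ k = ?dZ (X x) $ k + GZ k" for k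
    by (simp add: cov_deriv_def GZ_def)
  have lowsum: "(\<Sum>k\<in>UNIV. g x $ m $ k * (\<Sum>i\<in>UNIV. \<Sum>j\<in>UNIV. christoffel g k i j x * X x $ i * V $ j)) =
      (\<Sum>i\<in>UNIV. \<Sum>j\<in>UNIV. 1/2 * (p i j m + p j i m - p m i j) * X x $ i * V $ j)" for m and V :: "real^'a"
  proof -
    have "(\<Sum>k\<in>UNIV. g x $ m $ k * (\<Sum>i\<in>UNIV. \<Sum>j\<in>UNIV. christoffel g k i j x * X x $ i * V $ j)) =
      (\<Sum>k\<in>UNIV. \<Sum>i\<in>UNIV. \<Sum>j\<in>UNIV. g x $ m $ k * christoffel g k i j x * X x $ i * V $ j)"
      by (simp add: sum_distrib_left mult.assoc)
    also have "\<dots> = (\<Sum>i\<in>UNIV. \<Sum>j\<in>UNIV. \<Sum>k\<in>UNIV. g x $ m $ k * christoffel g k i j x * X x $ i * V $ j)"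
      by (subst sum.swap, rule sum.cong[OF refl], rule sum.swap)
    also have "\<dots> = (\<Sum>i\<in>UNIV. \<Sum>j\<in>UNIV. (\<Sum>k\<in>UNIV. g x $ m $ k * christoffel g k i j x) * X x $ i * V $ j)"
      by (simp add: sum_distrib_right)
    finally show ?thesis by (simp only: low)
  qed
  have A: "metric_apply g (cov_deriv g X Y) Z x =
    (\<Sum>i\<in>UNIV. \<Sum>j\<in>UNIV. g x $ i $ j * ?dY (X x) $ i * Z x $ j)
    + (\<Sum>m\<in>UNIV. \<Sum>i\<in>UNIV. \<Sum>j\<in>UNIV. 1/2 * (p i j m + p j i m - p m i j) * X x $ i * Y x $ j * Z x $ m)"
  proof -
    have "metric_apply g (cov_deriv g X Y) Z x =
      (\<Sum>i\<in>UNIV. \<Sum>j\<in>UNIV. g x $ i $ j * ?dY (X x) $ i * Z x $ j) + (\<Sum>i\<in>UNIV. \<Sum>j\<in>UNIV. g x $ i $ j * GY i * Z x $ j)"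
      by (simp add: metric_apply_def inner_vec_def matrix_vector_mult_def sum_distrib_left
          cY algebra_simps sum.distrib)
    also have "(\<Sum>i\<in>UNIV. \<Sum>j\<in>UNIV. g x $ i $ j * GY i * Z x $ j) = (\<Sum>j\<in>UNIV. (\<Sum>i\<in>UNIV. g x $ j $ i * GY i) * Z x $ j)"
      by (subst sum.swap) (simp add: sum_distrib_right sym)
    finally show ?thesis unfolding GY_def lowsum by (simp add: sum_distrib_right)
  qed
  have B: "metric_apply g Y (cov_deriv g X Z) x =
    (\<Sum>i\<in>UNIV. \<Sum>j\<in>UNIV. g x $ i $ j * Y x $ i * ?dZ (X x) $ j)
    + (\<Sum>m\<in>UNIV. \<Sum>i\<in>UNIV. \<Sum>j\<in>UNIV. 1/2 * (p i j m + p j i m - p m i j) * X x $ i * Z x $ j * Y x $ m)"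
  proof -
    have "metric_apply g Y (cov_deriv g X Z) x =
      (\<Sum>i\<in>UNIV. \<Sum>j\<in>UNIV. g x $ i $ j * Y x $ i * ?dZ (X x) $ j) + (\<Sum>i\<in>UNIV. \<Sum>j\<in>UNIV. Y x $ i * g x $ i $ j * GZ j)"
      by (simp add: metric_apply_def inner_vec_def matrix_vector_mult_def sum_distrib_left
          cZ algebra_simps sum.distrib)
    also have "(\<Sum>i\<in>UNIV. \<Sum>j\<in>UNIV. Y x $ i * g x $ i $ j * GZ j) = (\<Sum>i\<in>UNIV. (\<Sum>j\<in>UNIV. g x $ i $ j * GZ j) * Y x $ i)"
      by (simp add: sum_distrib_left mult.commute mult.left_commute)
    finally show ?thesis unfolding GZ_def lowsum by (simp add: sum_distrib_right)
  qed
  have s1: "(\<Sum>m\<in>UNIV. \<Sum>i\<in>UNIV. \<Sum>j\<in>UNIV. 1/2 * (p i j m + p j i m - p m i j) * X x $ i * Y x $ j * Z x $ m)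
    = (\<Sum>i\<in>UNIV. \<Sum>j\<in>UNIV. \<Sum>m\<in>UNIV. 1/2 * (p m i j + p i m j - p j m i) * X x $ m * Y x $ i * Z x $ j)"
  proof -
    have "(\<Sum>m\<in>UNIV. \<Sum>i\<in>UNIV. \<Sum>j\<in>UNIV. F m i j) = (\<Sum>i\<in>UNIV. \<Sum>j\<in>UNIV. \<Sum>m\<in>UNIV. F j m i)"
      for F :: "'a \<Rightarrow> 'a \<Rightarrow> 'a \<Rightarrow> real"
    proof -
      have "(\<Sum>m\<in>UNIV. \<Sum>i\<in>UNIV. \<Sum>j\<in>UNIV. F m i j) = (\<Sum>m\<in>UNIV. \<Sum>j\<in>UNIV. \<Sum>i\<in>UNIV. F m i j)"
        by (rule sum.cong[OF refl], rule sum.swap)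
      also have "\<dots> = (\<Sum>j\<in>UNIV. \<Sum>m\<in>UNIV. \<Sum>i\<in>UNIV. F m i j)" by (rule sum.swap)
      finally show ?thesis .
    qed
    from this[of "\<lambda>m i j. 1/2 * (p i j m + p j i m - p m i j) * X x $ i * Y x $ j * Z x $ m"]
    show ?thesis .
  qed
  have s2: "(\<Sum>m\<in>UNIV. \<Sum>i\<in>UNIV. \<Sum>j\<in>UNIV. 1/2 * (p i j m + p j i m - p m i j) * X x $ i * Z x $ j * Y x $ m)
    = (\<Sum>i\<in>UNIV. \<Sum>j\<in>UNIV. \<Sum>m\<in>UNIV. 1/2 * (p m j i + p j m i - p i m j) * X x $ m * Z x $ j * Y x $ i)"
    by (rule sum.cong[OF refl], rule sum.swap)
  have t: "(\<Sum>l\<in>UNIV. X x $ l * p l i j) * Y x $ i * Z x $ j =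
      (\<Sum>m\<in>UNIV. 1/2 * (p m i j + p i m j - p j m i) * X x $ m * Y x $ i * Z x $ j)
    + (\<Sum>m\<in>UNIV. 1/2 * (p m j i + p j m i - p i m j) * X x $ m * Z x $ j * Y x $ i)" for i j
    unfolding sum.distrib[symmetric] sum_distrib_right psym[of _ j i]
    by (rule sum.cong[OF refl]) (simp add: algebra_simps)
  show ?thesis
    unfolding lhs A B s1 s2 dg t sum.distrib by simp
qed

section \<open>The Walker metrics \<open>g\<^sub>a\<close> on \<open>\<real>\<^sup>4\<close>\<close>

definition walker_metric :: "(real^4 \<Rightarrow> real) \<Rightarrow> 4 metric" where
  "walker_metric a x = (\<chi> i j.
     if (i, j) \<in> {(1, 3), (3, 1), (2, 4), (4, 2)} then 1
     else if (i, j) \<in> {(3, 3), (4, 4)} then a x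
     else 0)"

lemma smooth_on_const: "smooth_on S (\<lambda>_. c)"
proof -
  have "Ck_on n S (\<lambda>_. c)" for n and c :: 'b
    by (induction n arbitrary: c) (simp_all add: frechet_derivative_const)
  then show ?thesis by (simp add: smooth_on_def)
qed

lemma pseudo_metric_on_walker:
  assumes "smooth_on S a"
  shows "pseudo_metric_on S (walker_metric a)"
proof -
  define h :: "real^4 \<Rightarrow> real^4^4" where "h x = (\<chi> i j.
     if (i, j) \<in> {(1, 3), (3, 1), (2, 4), (4, 2)} then 1
     else if (i, j) \<in> {(1, 1), (2, 2)} then - a x else 0)" for x
  have "walker_metric a x ** h x = mat 1" "h x ** walker_metric a x = mat 1" for x
    by (simp_all add: vec_eq_iff forall_4 matrix_matrix_mult_def sum_4 mat_def walker_metric_def h_def)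
  then have "invertible (walker_metric a x)" for x
    unfolding invertible_def by blast
  moreover have "transpose (walker_metric a x) = walker_metric a x" for x
    by (simp add: vec_eq_iff forall_4 transpose_def walker_metric_def)
  moreover have "smooth_on S (\<lambda>x. walker_metric a x $ i $ j)" for i j
    using assms
    by (cases "(i, j) \<in> {(1, 3), (3, 1), (2, 4), (4, 2)}"; cases "(i, j) \<in> {(3, 3), (4, 4)}")
      (simp_all only: walker_metric_def vec_lambda_beta if_True if_False smooth_on_const)
  ultimately show ?thesis by (simp add: pseudo_metric_on_def)
qed

text \<open>
  Functions of \<open>(x\<^sub>3, x\<^sub>4)\<close> live on the projection of the domain to the \<open>(x\<^sub>3, x\<^sub>4)\<close>-plane;
  \<open>D3\<close> and \<open>D4\<close> are \<open>\<partial>/\<partial>x\<^sub>3\<close> and \<open>\<partial>/\<partial>x\<^sub>4\<close> there.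
\<close>

definition proj34 :: "real^4 \<Rightarrow> real \<times> real" where
  "proj34 x = (x $ 3, x $ 4)"

definition D3 :: "(real \<times> real \<Rightarrow> real) \<Rightarrow> real \<times> real \<Rightarrow> real" where
  "D3 f p = frechet_derivative f (at p) (1, 0)"

definition D4 :: "(real \<times> real \<Rightarrow> real) \<Rightarrow> real \<times> real \<Rightarrow> real" where
  "D4 f p = frechet_derivative f (at p) (0, 1)"

text \<open>
  Beware that a local solution \<open>k\<close>, \<open>l\<close> need not be a global one when \<open>S\<close> is disconnected: for
  \<open>c = d = 0\<close> and \<open>b\<close> equal to \<open>0\<close> and \<open>1\<close> on two components with overlapping \<open>x\<^sub>4\<close>-ranges, the first
  equation forces different values of \<open>k\<close> at the same \<open>x\<^sub>4\<close>, although the Ricci tensor is parallel.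
\<close>

definition parallel_system ::
  "(real \<times> real \<Rightarrow> real) \<Rightarrow> (real \<times> real \<Rightarrow> real) \<Rightarrow> (real \<Rightarrow> real) \<Rightarrow> (real \<Rightarrow> real) \<Rightarrow>
   (real^4) set \<Rightarrow> bool" where
  "parallel_system b c k l S \<longleftrightarrow> (\<forall>p \<in> proj34 ` S.
     (b p)\<^sup>2 = 2 * D3 b p + k (snd p) \<and>
     (c p)\<^sup>2 = 2 * D4 c p + l (fst p) \<and>
     3 * c p * D3 c p - 2 * D3 (D4 c) p - 2 * b p * D4 c p + D4 b p * c p = 0 \<and>
     4 * c p * D3 b p + b p * D3 c p - 2 * D3 (D4 b) p - 2 * D3 (D3 c) p - b p * D4 b p = 0 \<and>
     c p * D4 b p + 4 * b p * D4 c p - 2 * D4 (D4 b) p - 2 * D3 (D4 c) p - c p * D3 c p = 0 \<and>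
     3 * b p * D4 b p - 2 * D3 (D4 b) p + b p * D3 c p - 2 * c p * D3 b p = 0)"

end

theory Submission
  imports Defs
begin

text \<open>
  The Ricci tensor \<open>\<rho>\<close> of \<open>g\<^sub>a\<close> has only the components
  \<open>\<rho>\<^sub>3\<^sub>3 = c\<^sup>2/2 - c\<^sub>4\<close>, \<open>\<rho>\<^sub>3\<^sub>4 = (b\<^sub>4 + c\<^sub>3 - b c)/2\<close> and \<open>\<rho>\<^sub>4\<^sub>4 = b\<^sup>2/2 - b\<^sub>3\<close>, which are functions of
  \<open>(x\<^sub>3, x\<^sub>4)\<close>. Its covariant derivative has six independent components that need not vanish.
  Four of them are, up to non-zero factors, the four equations without \<open>k\<close> and \<open>l\<close>. The other two are
  \<open>\<partial>\<^sub>3 \<rho>\<^sub>4\<^sub>4\<close> and \<open>\<partial>\<^sub>4 \<rho>\<^sub>3\<^sub>3\<close> (\<open>coord_ricci_eq\<close>, \<open>coord_deriv_ricci_eq\<close>). Hence \<open>\<rho>\<close> is parallel if and only if a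
  system of six pointwise equations holds on the projection of \<open>\<Omega>\<close> to the plane
  (\<open>parallel_ricci_on_walker_iff\<close>). This rests on the tensoriality of \<open>\<rho>\<close> and \<open>\<nabla>\<rho>\<close> (\<open>ricci_eq_coord\<close>,
  \<open>cov_deriv_ricci_eq_coord\<close>), and thereby on Schwarz' theorem (\<open>smooth_on_second_derivative_symmetric\<close>).

  It remains to integrate \<open>\<partial>\<^sub>3 \<rho>\<^sub>4\<^sub>4 = 0\<close> and \<open>\<partial>\<^sub>4 \<rho>\<^sub>3\<^sub>3 = 0\<close>. By themselves these equations provide \<open>k\<close>
  and \<open>l\<close> only locally, because a line parallel to an axis may meet the projection of a connected
  set in several pieces.
  The remaining equations help. Since \<open>\<Gamma>\<^sup>m\<^sub>3\<^sub>3 = \<Gamma>\<^sup>m\<^sub>4\<^sub>4\<close> and \<open>\<Gamma>\<^sup>m\<^sub>3\<^sub>4 = 0\<close> for \<open>m = 3, 4\<close>, they imply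
  \<open>\<partial>\<^sub>4 \<rho>\<^sub>4\<^sub>4 = 2 \<partial>\<^sub>3 \<rho>\<^sub>3\<^sub>4\<close> and \<open>\<partial>\<^sub>3 \<rho>\<^sub>3\<^sub>3 = 2 \<partial>\<^sub>4 \<rho>\<^sub>3\<^sub>4\<close>. So \<open>\<partial>\<^sub>4\<^sup>2 \<rho>\<^sub>4\<^sub>4 = \<partial>\<^sub>3\<^sup>2 \<rho>\<^sub>3\<^sub>3\<close> is annihilated by both
  \<open>\<partial>\<^sub>3\<close> and \<open>\<partial>\<^sub>4\<close>, hence constant on a connected set, and \<open>2 \<rho>\<^sub>4\<^sub>4\<close> and \<open>2 \<rho>\<^sub>3\<^sub>3\<close> are there quadratic polynomials
  in \<open>x\<^sub>4\<close> and in \<open>x\<^sub>3\<close>. These polynomials are \<open>k\<close> and \<open>l\<close> (\<open>global_separation\<close>,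
  \<open>coefficient_system_imp_parallel_system\<close>).
\<close>

section \<open>Calculus of smooth functions on open sets\<close>

lemma frechet_derivative_apply:
  "(f has_derivative F) (at x) \<Longrightarrow> frechet_derivative f (at x) v = F v"
  using frechet_derivative_at by metis

lemma Ck_on_cong:
  assumes "open S" and "\<And>x. x \<in> S \<Longrightarrow> f x = g x"
  shows "Ck_on n S f \<longleftrightarrow> Ck_on n S g"
  using assms(2)
proof (induction n arbitrary: f g)
  case 0
  then show ?case by (simp cong: continuous_on_cong)
next
  case (Suc n)
  have d: "(f has_derivative F) (at x) \<longleftrightarrow> (g has_derivative F) (at x)" if "x \<in> S" for F x
    using has_derivative_transform_within_open[of f F x UNIV S g]
      has_derivative_transform_within_open[of g F x UNIV S f] Suc.prems \<open>open S\<close> that by auto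
  then have "frechet_derivative f (at x) = frechet_derivative g (at x)" if "x \<in> S" for x
    using that by (simp add: frechet_derivative_def)
  then have "Ck_on n S (\<lambda>x. frechet_derivative f (at x) v) \<longleftrightarrow>
      Ck_on n S (\<lambda>x. frechet_derivative g (at x) v)" for v
    by (intro Suc.IH) simp
  then show ?case using d by (simp add: differentiable_def)
qed

lemma smooth_on_cong:
  assumes "open S" and "\<And>x. x \<in> S \<Longrightarrow> f x = g x"
  shows "smooth_on S f \<longleftrightarrow> smooth_on S g"
  using Ck_on_cong[OF assms] by (simp add: smooth_on_def)

lemma smooth_on_differentiable:
  "smooth_on S f \<Longrightarrow> x \<in> S \<Longrightarrow> f differentiable (at x)"
  unfolding smooth_on_def using Ck_on.simps(2)[of 0 S f] by blast

lemma smooth_on_frechet_derivative: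
  "smooth_on S f \<Longrightarrow> smooth_on S (\<lambda>x. frechet_derivative f (at x) v)"
  unfolding smooth_on_def using Ck_on.simps(2) by blast

lemma smooth_on_continuous_on:
  "smooth_on S f \<Longrightarrow> continuous_on S f"
  unfolding smooth_on_def using Ck_on.simps(1) by blast

lemma Ck_on_lower: "Ck_on (Suc n) S f \<Longrightarrow> Ck_on n S f"
proof (induction n arbitrary: f)
  case 0
  then show ?case
    by (auto intro!: continuous_at_imp_continuous_on differentiable_imp_continuous_within)
next
  case (Suc n)
  then show ?case by auto
qed

lemma Ck_on_subset: "Ck_on n S f \<Longrightarrow> T \<subseteq> S \<Longrightarrow> Ck_on n T f"
  by (induction n arbitrary: f) (auto intro: continuous_on_subset)

lemma smooth_on_subset: "smooth_on S f \<Longrightarrow> T \<subseteq> S \<Longrightarrow> smooth_on T f"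
  unfolding smooth_on_def using Ck_on_subset by blast

text \<open>
  The derivative need not be given as \<open>frechet_derivative\<close>; this makes the closure properties
  below inductions in which only the relevant differentiation rule is needed.
\<close>

lemma Ck_on_SucI:
  assumes "open S" and d: "\<And>x. x \<in> S \<Longrightarrow> (f has_derivative f' x) (at x)"
    and "\<And>v. Ck_on n S (\<lambda>x. f' x v)"
  shows "Ck_on (Suc n) S f"
proof -
  have "Ck_on n S (\<lambda>x. frechet_derivative f (at x) v)" for v
    using Ck_on_cong[OF assms(1), of "\<lambda>x. frechet_derivative f (at x) v" "\<lambda>x. f' x v" n]
      frechet_derivative_apply[OF d] assms(3) by blast
  then show ?thesis using d by (auto simp: differentiable_def)
qed

lemma Ck_on_SucD:
  assumes "Ck_on (Suc n) S f"
  shows "x \<in> S \<Longrightarrow> (f has_derivative frechet_derivative f (at x)) (at x)"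
    and "Ck_on n S (\<lambda>x. frechet_derivative f (at x) v)"
  using assms by (auto simp: frechet_derivative_works)

lemma Ck_on_add:
  assumes "open S" "Ck_on n S f" "Ck_on n S g"
  shows "Ck_on n S (\<lambda>x. f x + g x)"
  using assms(2,3)
proof (induction n arbitrary: f g)
  case 0
  then show ?case by (simp add: continuous_on_add)
next
  case (Suc n)
  show ?case
    by (rule Ck_on_SucI[OF \<open>open S\<close>
          has_derivative_add[OF Ck_on_SucD(1)[OF Suc.prems(1)] Ck_on_SucD(1)[OF Suc.prems(2)]]])
      (auto intro!: Suc.IH Ck_on_SucD(2) Suc.prems)
qed

lemma Ck_on_compose_linear_left:
  assumes "open S" "bounded_linear L" "Ck_on n S f"
  shows "Ck_on n S (\<lambda>x. L (f x))"
  using assms(3)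
proof (induction n arbitrary: f)
  case 0
  then show ?case using bounded_linear.continuous_on[OF assms(2)] by simp
next
  case (Suc n)
  show ?case
    by (rule Ck_on_SucI[OF \<open>open S\<close>
          bounded_linear.has_derivative[OF assms(2) Ck_on_SucD(1)[OF Suc.prems]]])
      (auto intro!: Suc.IH Ck_on_SucD(2) Suc.prems)
qed

lemma Ck_on_compose_linear_right:
  assumes "open S" "bounded_linear L" "L ` S \<subseteq> T" "Ck_on n T f"
  shows "Ck_on n S (\<lambda>x. f (L x))"
  using assms(4)
proof (induction n arbitrary: f)
  case 0
  then show ?case
    using assms(3) linear_continuous_on[OF assms(2)]
    by (auto intro: continuous_on_compose2)
next
  case (Suc n)
  show ?case
  proof (rule Ck_on_SucI[OF \<open>open S\<close>])
    show "((\<lambda>x. f (L x)) has_derivative (\<lambda>v. frechet_derivative f (at (L x)) (L v))) (at x)"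
      if "x \<in> S" for x
      using that assms(3)
      by (intro has_derivative_compose[OF bounded_linear_imp_has_derivative[OF assms(2)]]
          Ck_on_SucD(1)[OF Suc.prems]) auto
    show "Ck_on n S (\<lambda>x. frechet_derivative f (at (L x)) (L v))" for v
      by (rule Suc.IH[OF Ck_on_SucD(2)[OF Suc.prems]])
  qed
qed

lemma Ck_on_mult:
  fixes f g :: "'a::real_normed_vector \<Rightarrow> real"
  assumes "open S" "Ck_on n S f" "Ck_on n S g"
  shows "Ck_on n S (\<lambda>x. f x * g x)"
  using assms(2,3)
proof (induction n arbitrary: f g)
  case 0
  then show ?case by (simp add: continuous_on_mult)
next
  case (Suc n)
  show ?case
  proof (rule Ck_on_SucI[OF \<open>open S\<close>])
    show "((\<lambda>x. f x * g x) has_derivative (\<lambda>v. f x * frechet_derivative g (at x) v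
        + frechet_derivative f (at x) v * g x)) (at x)" if "x \<in> S" for x
      by (rule has_derivative_mult[OF Ck_on_SucD(1)[OF Suc.prems(1) that] Ck_on_SucD(1)[OF Suc.prems(2) that]])
    show "Ck_on n S (\<lambda>x. f x * frechet_derivative g (at x) v
        + frechet_derivative f (at x) v * g x)" for v
      by (intro Ck_on_add[OF \<open>open S\<close>] Suc.IH Ck_on_lower[OF Suc.prems(1)] Ck_on_lower[OF Suc.prems(2)]
          Ck_on_SucD(2)[OF Suc.prems(1)] Ck_on_SucD(2)[OF Suc.prems(2)])
  qed
qed

lemma smooth_on_add:
  "open S \<Longrightarrow> smooth_on S f \<Longrightarrow> smooth_on S g \<Longrightarrow> smooth_on S (\<lambda>x. f x + g x)"
  by (simp add: smooth_on_def Ck_on_add)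

lemma smooth_on_mult:
  fixes f g :: "'a::real_normed_vector \<Rightarrow> real"
  shows "open S \<Longrightarrow> smooth_on S f \<Longrightarrow> smooth_on S g \<Longrightarrow> smooth_on S (\<lambda>x. f x * g x)"
  by (simp add: smooth_on_def Ck_on_mult)

lemma smooth_on_compose_linear_left:
  "open S \<Longrightarrow> bounded_linear L \<Longrightarrow> smooth_on S f \<Longrightarrow> smooth_on S (\<lambda>x. L (f x))"
  by (simp add: smooth_on_def Ck_on_compose_linear_left)

lemma smooth_on_compose_linear_right:
  "open S \<Longrightarrow> bounded_linear L \<Longrightarrow> L ` S \<subseteq> T \<Longrightarrow> smooth_on T f \<Longrightarrow> smooth_on S (\<lambda>x. f (L x))"
  by (simp add: smooth_on_def Ck_on_compose_linear_right)

lemma smooth_on_minus: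
  fixes f :: "'a::real_normed_vector \<Rightarrow> real"
  shows "open S \<Longrightarrow> smooth_on S f \<Longrightarrow> smooth_on S (\<lambda>x. - f x)"
  by (rule smooth_on_compose_linear_left) (auto intro: bounded_linear_minus bounded_linear_ident)

lemma smooth_on_diff:
  fixes f g :: "'a::real_normed_vector \<Rightarrow> real"
  shows "open S \<Longrightarrow> smooth_on S f \<Longrightarrow> smooth_on S g \<Longrightarrow> smooth_on S (\<lambda>x. f x - g x)"
  using smooth_on_add[of S f "\<lambda>x. - g x"] smooth_on_minus[of S g] by simp

lemma smooth_on_divide_const:
  fixes f :: "'a::real_normed_vector \<Rightarrow> real"
  shows "open S \<Longrightarrow> smooth_on S f \<Longrightarrow> smooth_on S (\<lambda>x. f x / r)"
  by (rule smooth_on_compose_linear_left[OF _ bounded_linear_divide])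

lemma smooth_on_if:
  "smooth_on S f \<Longrightarrow> smooth_on S h \<Longrightarrow> smooth_on S (\<lambda>x. if P then f x else h x)"
  by (cases P) simp_all

lemma smooth_on_sum:
  assumes "open S" "\<And>i. i \<in> I \<Longrightarrow> smooth_on S (f i)"
  shows "smooth_on S (\<lambda>x. \<Sum>i\<in>I. f i x)"
  using assms(2)
  by (induction I rule: infinite_finite_induct)
    (simp_all add: smooth_on_const smooth_on_add[OF \<open>open S\<close>])

lemma smooth_on_linear:
  assumes "open S" "bounded_linear L"
  shows "smooth_on S L"
proof -
  have "smooth_on S (\<lambda>x. x :: 'a)"
    unfolding smooth_on_def
  proof
    show "Ck_on n S (\<lambda>x. x)" for n
      using smooth_on_const by (cases n) (auto simp: smooth_on_def)
  qed
  then show ?thesis using smooth_on_compose_linear_left[OF assms, of "\<lambda>x. x"] by simp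
qed

lemma smooth_on_vec_iff:
  fixes Y :: "'a::real_normed_vector \<Rightarrow> real^'n"
  assumes "open S"
  shows "smooth_on S Y \<longleftrightarrow> (\<forall>k. smooth_on S (\<lambda>x. Y x $ k))"
proof
  assume "smooth_on S Y"
  then show "\<forall>k. smooth_on S (\<lambda>x. Y x $ k)"
    using smooth_on_compose_linear_left[OF assms bounded_linear_vec_nth] by blast
next
  assume r: "\<forall>k. smooth_on S (\<lambda>x. Y x $ k)"
  have "smooth_on S (\<lambda>x. \<Sum>k\<in>UNIV. Y x $ k *\<^sub>R (axis k 1 :: real^'n))"
    using r smooth_on_compose_linear_left[OF assms bounded_linear_scaleR_left]
    by (intro smooth_on_sum[OF assms]) blast
  moreover have "(\<lambda>x. \<Sum>k\<in>UNIV. Y x $ k *\<^sub>R axis k 1) = Y"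
    using basis_expansion[where 'a=real and 'n='n] by (simp add: fun_eq_iff scalar_mult_eq_scaleR)
  ultimately show "smooth_on S Y" by (simp only:)
qed

section \<open>Symmetry of the second derivative\<close>

text \<open>
  Two applications of the mean value theorem express the second difference of \<open>f\<close> over a small
  parallelogram through the mixed second derivative at some point of the parallelogram. The second
  difference is symmetric in \<open>u\<close> and \<open>v\<close>, so shrinking the parallelogram yields Schwarz' theorem.
\<close>

lemma second_difference_mean_value:
  fixes f :: "'a::real_normed_vector \<Rightarrow> real"
  assumes f: "Ck_on 2 (ball x r) f" and "h > 0" and h: "h * (norm u + norm v) < r"
  shows "\<exists>y. dist x y \<le> h * (norm u + norm v) \<and>
    f (x + h *\<^sub>R u + h *\<^sub>R v) - f (x + h *\<^sub>R u) - f (x + h *\<^sub>R v) + f x =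
    h\<^sup>2 * frechet_derivative (\<lambda>z. frechet_derivative f (at z) u) (at y) v"
proof -
  let ?Du = "\<lambda>z. frechet_derivative f (at z) u"
  have near: "dist x (x + s *\<^sub>R u + t *\<^sub>R v) \<le> h * (norm u + norm v)"
    if "0 \<le> s" "s \<le> h" "0 \<le> t" "t \<le> h" for s t
  proof -
    have "norm (s *\<^sub>R u + t *\<^sub>R v) \<le> s * norm u + t * norm v"
      using norm_triangle_ineq[of "s *\<^sub>R u" "t *\<^sub>R v"] that by simp
    also have "\<dots> \<le> h * norm u + h * norm v"
      using that by (intro add_mono mult_right_mono) auto
    finally show ?thesis
      using norm_minus_cancel[of "s *\<^sub>R u + t *\<^sub>R v"] by (simp add: dist_norm algebra_simps)
  qed
  have f1: "(f has_derivative frechet_derivative f (at z)) (at z)"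
    and f2: "(?Du has_derivative frechet_derivative ?Du (at z)) (at z)" if "dist x z \<le> h * (norm u + norm v)" for z
    using f h that by (auto simp: numeral_2_eq_2 frechet_derivative_works)
  have lin: "frechet_derivative f (at z) (t *\<^sub>R u) = t * ?Du z"
    "frechet_derivative ?Du (at z) (t *\<^sub>R v) = t * frechet_derivative ?Du (at z) v"
    if "dist x z \<le> h * (norm u + norm v)" for z t
    using f1[OF that] f2[OF that] by (simp_all add: has_derivative_linear linear_cmul)
  define \<phi> where "\<phi> s = f (x + s *\<^sub>R u + h *\<^sub>R v) - f (x + s *\<^sub>R u)" for s
  have d\<phi>: "(\<phi> has_derivative (\<lambda>t. t * (?Du (x + s *\<^sub>R u + h *\<^sub>R v) - ?Du (x + s *\<^sub>R u)))) (at s)"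
    if "0 \<le> s" "s \<le> h" for s
    unfolding \<phi>_def
    using near[of s h] near[of s 0] that \<open>h > 0\<close>
    by (auto intro!: derivative_eq_intros has_derivative_compose[OF _ f1] simp: lin algebra_simps)
  obtain s where s: "0 < s" "s < h"
    "\<phi> h - \<phi> 0 = h * (?Du (x + s *\<^sub>R u + h *\<^sub>R v) - ?Du (x + s *\<^sub>R u))"
    using mvt_simple[OF \<open>h > 0\<close> has_derivative_at_withinI[OF d\<phi>]] by auto
  have dDu: "((\<lambda>t. ?Du (x + s *\<^sub>R u + t *\<^sub>R v)) has_derivative
      (\<lambda>\<tau>. \<tau> * frechet_derivative ?Du (at (x + s *\<^sub>R u + t *\<^sub>R v)) v)) (at t)"
    if "0 \<le> t" "t \<le> h" for t
  proof -
    have n: "dist x (x + s *\<^sub>R u + t *\<^sub>R v) \<le> h * (norm u + norm v)"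
      using near[of s t] that s by simp
    have "((\<lambda>t. x + s *\<^sub>R u + t *\<^sub>R v) has_derivative (\<lambda>\<tau>. \<tau> *\<^sub>R v)) (at t)"
      by (auto intro!: derivative_eq_intros)
    from has_derivative_compose[OF this f2[OF n]] show ?thesis
      by (simp only: lin(2)[OF n])
  qed
  obtain t where t: "0 < t" "t < h"
    "?Du (x + s *\<^sub>R u + h *\<^sub>R v) - ?Du (x + s *\<^sub>R u) =
       h * frechet_derivative ?Du (at (x + s *\<^sub>R u + t *\<^sub>R v)) v"
    using mvt_simple[OF \<open>h > 0\<close> has_derivative_at_withinI[OF dDu]] by auto
  show ?thesis
    using near[of s t] s t by (intro exI[of _ "x + s *\<^sub>R u + t *\<^sub>R v"])
      (auto simp: \<phi>_def power2_eq_square mult.assoc)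
qed

lemma smooth_on_second_derivative_symmetric:
  fixes f :: "'a::real_normed_vector \<Rightarrow> real"
  assumes "open S" "smooth_on S f" "x \<in> S"
  shows "frechet_derivative (\<lambda>z. frechet_derivative f (at z) u) (at x) v =
    frechet_derivative (\<lambda>z. frechet_derivative f (at z) v) (at x) u" (is "?A x = ?B x")
proof -
  obtain r where r: "r > 0" "ball x r \<subseteq> S"
    using assms by (meson openE)
  define K where "K = norm u + norm v"
  \<comment> \<open>Scales tending to \<open>0\<close> with \<open>h n * K < r\<close>; the summand \<open>1\<close> covers \<open>u = v = 0\<close>.\<close>
  define h where "h n = r / ((K + 1) * (real n + 2))" for n
  have K: "K \<ge> 0" by (simp add: K_def)
  have hpos: "h n > 0" for n
    using r K by (simp add: h_def)
  have hK: "h n * K < r" for n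
  proof -
    have "K < (K + 1) * (real n + 2)"
      using K by (simp add: algebra_simps) (smt (verit) mult_nonneg_nonneg of_nat_0_le_iff)
    then show ?thesis
      using r K by (simp add: h_def divide_simps)
  qed
  have h0: "(\<lambda>n. h n * K) \<longlonglongrightarrow> 0"
  proof -
    have "(\<lambda>n. (r * K / (K + 1)) * inverse (real (n + 2))) \<longlonglongrightarrow> (r * K / (K + 1)) * 0"
      by (intro tendsto_mult_left LIMSEQ_ignore_initial_segment[OF lim_inverse_n])
    then show ?thesis
      by (simp add: h_def field_simps)
  qed
  have C2: "Ck_on 2 (ball x r) f"
    using assms(2) r(2) Ck_on_subset unfolding smooth_on_def by blast
  have "\<exists>y. dist x y \<le> h n * K \<and>
      f (x + h n *\<^sub>R u + h n *\<^sub>R v) - f (x + h n *\<^sub>R u) - f (x + h n *\<^sub>R v) + f x = (h n)\<^sup>2 * ?A y" for n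
    using second_difference_mean_value[OF C2 hpos, of n u v] hK[of n] by (simp add: K_def)
  then obtain y where y: "\<And>n. dist x (y n) \<le> h n * K"
    "\<And>n. f (x + h n *\<^sub>R u + h n *\<^sub>R v) - f (x + h n *\<^sub>R u) - f (x + h n *\<^sub>R v) + f x = (h n)\<^sup>2 * ?A (y n)"
    by metis
  have "\<exists>y. dist x y \<le> h n * K \<and>
      f (x + h n *\<^sub>R v + h n *\<^sub>R u) - f (x + h n *\<^sub>R v) - f (x + h n *\<^sub>R u) + f x = (h n)\<^sup>2 * ?B y" for n
    using second_difference_mean_value[OF C2 hpos, of n v u] hK[of n] by (simp add: K_def add.commute)
  then obtain z where z: "\<And>n. dist x (z n) \<le> h n * K"
    "\<And>n. f (x + h n *\<^sub>R v + h n *\<^sub>R u) - f (x + h n *\<^sub>R v) - f (x + h n *\<^sub>R u) + f x = (h n)\<^sup>2 * ?B (z n)"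
    by metis
  have eq: "?A (y n) = ?B (z n)" for n
  proof -
    have "(h n)\<^sup>2 * ?A (y n) = (h n)\<^sup>2 * ?B (z n)"
      unfolding y(2)[symmetric] z(2)[symmetric] by (simp add: algebra_simps)
    then show ?thesis using hpos[of n] by simp
  qed
  have lim: "w \<longlonglongrightarrow> x" if "\<And>n. dist x (w n) \<le> h n * K" for w
    using that
    by (intro metric_tendsto_imp_tendsto[OF h0]) (auto simp: dist_commute K hpos less_imp_le intro!: always_eventually)
  have "isCont ?A x" "isCont ?B x"
    using assms smooth_on_continuous_on[OF smooth_on_frechet_derivative[OF smooth_on_frechet_derivative[OF assms(2)]]]
    by (auto simp: continuous_on_eq_continuous_at)
  then have "(\<lambda>n. ?A (y n)) \<longlonglongrightarrow> ?A x" "(\<lambda>n. ?B (z n)) \<longlonglongrightarrow> ?B x"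
    using lim[OF y(1)] lim[OF z(1)] by (auto intro: isCont_tendsto_compose)
  then show ?thesis
    unfolding eq by (rule LIMSEQ_unique)
qed

section \<open>Curvature and Ricci tensor in coordinates\<close>

lemma smooth_on_partial: "smooth_on S f \<Longrightarrow> smooth_on S (partial i f)"
  using smooth_on_frechet_derivative[of S f "axis i 1"] by (simp add: partial_def[abs_def])

lemma frechet_derivative_eq_sum_partial:
  fixes f :: "real^'n \<Rightarrow> real"
  assumes "f differentiable (at x)"
  shows "frechet_derivative f (at x) v = (\<Sum>i\<in>UNIV. v $ i * partial i f x)"
proof -
  have lin: "linear (frechet_derivative f (at x))"
    using assms by (rule linear_frechet_derivative)
  have "(\<Sum>i\<in>UNIV. v $ i *\<^sub>R axis i 1) = v"
    using basis_expansion[of v] by (simp add: scalar_mult_eq_scaleR)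
  then have "frechet_derivative f (at x) v = frechet_derivative f (at x) (\<Sum>i\<in>UNIV. v $ i *\<^sub>R axis i 1)"
    by (rule arg_cong[OF sym])
  then show ?thesis
    by (simp add: linear_sum[OF lin] linear_cmul[OF lin] partial_def)
qed

lemma partial_const [simp]: "partial i (\<lambda>_. c) x = 0"
  by (simp add: partial_def)

lemma partial_add:
  "f differentiable (at x) \<Longrightarrow> g differentiable (at x) \<Longrightarrow>
    partial i (\<lambda>y. f y + g y) x = partial i f x + partial i g x"
  unfolding partial_def
  by (rule frechet_derivative_apply[OF has_derivative_add]) (simp_all add: frechet_derivative_works)

lemma partial_mult:
  "f differentiable (at x) \<Longrightarrow> g differentiable (at x) \<Longrightarrow>
    partial i (\<lambda>y. f y * g y) x = partial i f x * g x + f x * partial i g x"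
  unfolding partial_def
  by (subst frechet_derivative_apply[OF has_derivative_mult]) (auto simp: frechet_derivative_works)

lemma partial_divide_const:
  "f differentiable (at x) \<Longrightarrow> partial i (\<lambda>y. f y / r) x = partial i f x / r"
  using partial_mult[of f x "\<lambda>_. 1 / r" i] by simp

lemma partial_minus:
  "f differentiable (at x) \<Longrightarrow> partial i (\<lambda>y. - f y) x = - partial i f x"
  using partial_mult[of "\<lambda>_. -1" x f i] by simp

lemma partial_diff:
  "f differentiable (at x) \<Longrightarrow> g differentiable (at x) \<Longrightarrow>
    partial i (\<lambda>y. f y - g y) x = partial i f x - partial i g x"
  using partial_add[of f x "\<lambda>y. - g y" i] partial_minus[of g x i] by simp

lemma partial_sum:
  "(\<And>k. k \<in> I \<Longrightarrow> f k differentiable (at x)) \<Longrightarrow>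
    partial i (\<lambda>y. \<Sum>k\<in>I. f k y) x = (\<Sum>k\<in>I. partial i (f k) x)"
  unfolding partial_def
  by (rule frechet_derivative_apply[OF has_derivative_sum]) (simp add: frechet_derivative_works)

lemma partial_commute:
  "open S \<Longrightarrow> smooth_on S f \<Longrightarrow> x \<in> S \<Longrightarrow> partial i (partial j f) x = partial j (partial i f) x"
  using smooth_on_second_derivative_symmetric[of S f x "axis j 1" "axis i 1"]
  by (simp add: partial_def[abs_def])

lemma frechet_derivative_vec_nth:
  fixes Y :: "'a::real_normed_vector \<Rightarrow> real^'n"
  assumes "Y differentiable (at x)"
  shows "frechet_derivative Y (at x) v $ k = frechet_derivative (\<lambda>y. Y y $ k) (at x) v"
  using frechet_derivative_apply[OF frechet_derivative_component[OF assms]] by simp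

text \<open>The \<open>k\<close>-th component of the covariant derivative of \<open>Z\<close> along the \<open>i\<close>-th coordinate field.\<close>

definition coord_deriv :: "'n::finite metric \<Rightarrow> 'n vfield \<Rightarrow> 'n \<Rightarrow> 'n \<Rightarrow> real^'n \<Rightarrow> real" where
  "coord_deriv g Z i k x = partial i (\<lambda>y. Z y $ k) x + (\<Sum>l\<in>UNIV. christoffel g k i l x * Z x $ l)"

text \<open>
  The component \<open>R\<^sup>k\<^sub>l\<^sub>i\<^sub>j\<close> of the curvature: the \<open>k\<close>-th component of \<open>R(\<partial>\<^sub>i, \<partial>\<^sub>j)\<partial>\<^sub>l\<close>, with the formula in
  Christoffel symbols as definition.
\<close>

definition coord_curvature :: "'n::finite metric \<Rightarrow> 'n \<Rightarrow> 'n \<Rightarrow> 'n \<Rightarrow> 'n \<Rightarrow> real^'n \<Rightarrow> real" where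
  "coord_curvature g k l i j x =
     partial i (christoffel g k j l) x - partial j (christoffel g k i l) x
     + (\<Sum>m\<in>UNIV. christoffel g k i m x * christoffel g m j l x - christoffel g k j m x * christoffel g m i l x)"

text \<open>
  The components \<open>\<rho>(\<partial>\<^sub>j, \<partial>\<^sub>k)\<close> of the Ricci tensor: the trace over the direction \<open>i\<close>, as in \<open>ricci\<close>.
\<close>

definition coord_ricci :: "'n::finite metric \<Rightarrow> 'n \<Rightarrow> 'n \<Rightarrow> real^'n \<Rightarrow> real" where
  "coord_ricci g j k x = (\<Sum>i\<in>UNIV. coord_curvature g i k i j x)"

text \<open>
  The components \<open>(\<nabla>\<^sub>i \<rho>)(\<partial>\<^sub>j, \<partial>\<^sub>k)\<close> of the covariant derivative of the Ricci tensor.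
\<close>

definition coord_deriv_ricci :: "'n::finite metric \<Rightarrow> 'n \<Rightarrow> 'n \<Rightarrow> 'n \<Rightarrow> real^'n \<Rightarrow> real" where
  "coord_deriv_ricci g i j k x = partial i (coord_ricci g j k) x
     - (\<Sum>m\<in>UNIV. christoffel g m i j x * coord_ricci g m k x)
     - (\<Sum>m\<in>UNIV. christoffel g m i k x * coord_ricci g j m x)"

lemma cov_deriv_nth:
  assumes "Z differentiable (at x)"
  shows "cov_deriv g X Z x $ k = (\<Sum>i\<in>UNIV. X x $ i * coord_deriv g Z i k x)"
proof -
  have "(\<lambda>y. Z y $ k) differentiable (at x)"
    using frechet_derivative_component[OF assms] by (auto simp: differentiable_def)
  then show ?thesis
    by (simp add: cov_deriv_def coord_deriv_def frechet_derivative_vec_nth[OF assms]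
        frechet_derivative_eq_sum_partial sum_distrib_left sum.distrib algebra_simps)
qed

text \<open>
  Bookkeeping for the two correction terms of the covariant derivative of a bilinear form \<open>r\<close>:
  \<open>v\<close> is the direction, \<open>y\<close> and \<open>d\<close> are the components of a field and of their partial derivatives,
  and \<open>G\<close> are the Christoffel symbols.
\<close>

lemma bilinear_cov_deriv_sum:
  fixes r d :: "'n::finite \<Rightarrow> 'n \<Rightarrow> real"
  shows "(\<Sum>j\<in>UNIV. \<Sum>k\<in>UNIV. r j k * (\<Sum>i\<in>UNIV. v i * (d i j + (\<Sum>l\<in>UNIV. G j i l * y l))) * z k) =
    (\<Sum>i\<in>UNIV. v i * ((\<Sum>j\<in>UNIV. \<Sum>k\<in>UNIV. r j k * d i j * z k) +
       (\<Sum>j\<in>UNIV. \<Sum>k\<in>UNIV. (\<Sum>m\<in>UNIV. G m i j * r m k) * y j * z k)))"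
proof -
  have G: "(\<Sum>j\<in>UNIV. \<Sum>k\<in>UNIV. (\<Sum>m\<in>UNIV. G m i j * r m k) * y j * z k) =
      (\<Sum>j\<in>UNIV. \<Sum>k\<in>UNIV. r j k * (\<Sum>l\<in>UNIV. G j i l * y l) * z k)" for i
  proof -
    have "(\<Sum>j\<in>UNIV. \<Sum>k\<in>UNIV. (\<Sum>m\<in>UNIV. G m i j * r m k) * y j * z k) =
        (\<Sum>j\<in>UNIV. \<Sum>m\<in>UNIV. \<Sum>k\<in>UNIV. G m i j * r m k * y j * z k)"
      unfolding sum_distrib_right by (intro sum.cong refl sum.swap)
    also have "\<dots> = (\<Sum>m\<in>UNIV. \<Sum>j\<in>UNIV. \<Sum>k\<in>UNIV. G m i j * r m k * y j * z k)"
      by (rule sum.swap)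
    also have "\<dots> = (\<Sum>m\<in>UNIV. \<Sum>k\<in>UNIV. \<Sum>j\<in>UNIV. G m i j * r m k * y j * z k)"
      by (intro sum.cong refl sum.swap)
    finally show ?thesis by (simp add: sum_distrib_left sum_distrib_right mult_ac)
  qed
  have "(\<Sum>j\<in>UNIV. \<Sum>k\<in>UNIV. r j k * (\<Sum>i\<in>UNIV. v i * e i j) * z k) =
      (\<Sum>i\<in>UNIV. v i * (\<Sum>j\<in>UNIV. \<Sum>k\<in>UNIV. r j k * e i j * z k))" for e
  proof -
    have "(\<Sum>j\<in>UNIV. \<Sum>k\<in>UNIV. r j k * (\<Sum>i\<in>UNIV. v i * e i j) * z k) =
        (\<Sum>j\<in>UNIV. \<Sum>i\<in>UNIV. \<Sum>k\<in>UNIV. r j k * (v i * e i j) * z k)"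
      unfolding sum_distrib_left sum_distrib_right by (intro sum.cong refl sum.swap)
    also have "\<dots> = (\<Sum>i\<in>UNIV. \<Sum>j\<in>UNIV. \<Sum>k\<in>UNIV. r j k * (v i * e i j) * z k)"
      by (rule sum.swap)
    finally show ?thesis by (simp add: sum_distrib_left mult_ac)
  qed
  then show ?thesis
    unfolding G by (simp add: distrib_left distrib_right sum.distrib)
qed

text \<open>
  The tensoriality statements below hold for any \<open>g\<close> whose Christoffel symbols are smooth; neither
  symmetry nor invertibility of \<open>g\<close> enters.
\<close>

context
  fixes S :: "(real^'n::finite) set" and g :: "'n metric"
  assumes S: "open S" and \<Gamma>: "\<And>k i j. smooth_on S (christoffel g k i j)"
begin

lemma smooth_on_component:
  fixes Y :: "'n vfield"
  shows "smooth_on S Y \<Longrightarrow> smooth_on S (\<lambda>x. Y x $ k)"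
  by (rule iffD1[OF smooth_on_vec_iff[OF S], rule_format])

lemma smooth_on_coord_deriv: "smooth_on S Z \<Longrightarrow> smooth_on S (coord_deriv g Z i k)"
  unfolding coord_deriv_def[abs_def]
  by (intro smooth_on_add smooth_on_sum smooth_on_mult smooth_on_partial smooth_on_component S \<Gamma>)

lemma smooth_on_cov_deriv:
  assumes "smooth_on S X" "smooth_on S Z"
  shows "smooth_on S (cov_deriv g X Z)"
  unfolding smooth_on_vec_iff[OF S]
proof
  fix k
  have "smooth_on S (\<lambda>x. \<Sum>i\<in>UNIV. X x $ i * coord_deriv g Z i k x)"
    by (intro smooth_on_sum smooth_on_mult smooth_on_component smooth_on_coord_deriv S assms)
  then show "smooth_on S (\<lambda>x. cov_deriv g X Z x $ k)"
    by (subst smooth_on_cong[OF S cov_deriv_nth]) (auto intro: smooth_on_differentiable assms)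
qed

text \<open>
  The first sum is the only non-tensorial dependence on \<open>Y\<close>. In the curvature it cancels against
  the term with the Lie bracket.
\<close>

lemma second_cov_deriv_nth:
  assumes "smooth_on S X" "smooth_on S Y" "smooth_on S Z" "x \<in> S"
  shows "cov_deriv g X (cov_deriv g Y Z) x $ k =
    (\<Sum>j\<in>UNIV. (\<Sum>i\<in>UNIV. X x $ i * partial i (\<lambda>y. Y y $ j) x) * coord_deriv g Z j k x) +
    (\<Sum>i\<in>UNIV. \<Sum>j\<in>UNIV. X x $ i * Y x $ j *
      (partial i (coord_deriv g Z j k) x + (\<Sum>l\<in>UNIV. christoffel g k i l x * coord_deriv g Z j l x)))"
proof -
  note sm = smooth_on_component[OF assms(2)] smooth_on_coord_deriv[OF assms(3)]
  note df = smooth_on_differentiable[OF _ assms(4)]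
  have cn: "cov_deriv g Y Z y $ k = (\<Sum>j\<in>UNIV. Y y $ j * coord_deriv g Z j k y)" if "y \<in> S" for y k
    using smooth_on_differentiable[OF assms(3) that] by (rule cov_deriv_nth)
  have "partial i (\<lambda>y. cov_deriv g Y Z y $ k) x =
      partial i (\<lambda>y. \<Sum>j\<in>UNIV. Y y $ j * coord_deriv g Z j k y) x" for i
    by (rule partial_cong_open[OF S assms(4) cn])
  also have "\<dots> i = (\<Sum>j\<in>UNIV. partial i (\<lambda>y. Y y $ j) x * coord_deriv g Z j k x
      + Y x $ j * partial i (coord_deriv g Z j k) x)" for i
    by (simp add: partial_sum partial_mult differentiable_mult df sm)
  finally have p: "partial i (\<lambda>y. cov_deriv g Y Z y $ k) x =
      (\<Sum>j\<in>UNIV. partial i (\<lambda>y. Y y $ j) x * coord_deriv g Z j k x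
      + Y x $ j * partial i (coord_deriv g Z j k) x)" for i .
  have cd: "coord_deriv g (cov_deriv g Y Z) i k x =
      (\<Sum>j\<in>UNIV. partial i (\<lambda>y. Y y $ j) x * coord_deriv g Z j k x) +
      (\<Sum>j\<in>UNIV. Y x $ j * (partial i (coord_deriv g Z j k) x
        + (\<Sum>l\<in>UNIV. christoffel g k i l x * coord_deriv g Z j l x)))" for i
  proof -
    have "(\<Sum>l\<in>UNIV. christoffel g k i l x * (\<Sum>j\<in>UNIV. Y x $ j * coord_deriv g Z j l x)) =
        (\<Sum>j\<in>UNIV. Y x $ j * (\<Sum>l\<in>UNIV. christoffel g k i l x * coord_deriv g Z j l x))"
      unfolding sum_distrib_left by (subst sum.swap) (simp add: mult.left_commute)
    then show ?thesis
      unfolding coord_deriv_def[of g "cov_deriv g Y Z"] p cn[OF assms(4)]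
      by (simp add: sum.distrib distrib_left)
  qed
  have "cov_deriv g X (cov_deriv g Y Z) x $ k = (\<Sum>i\<in>UNIV. X x $ i * coord_deriv g (cov_deriv g Y Z) i k x)"
    by (rule cov_deriv_nth[OF df[OF smooth_on_cov_deriv[OF assms(2,3)]]])
  also have "\<dots> = (\<Sum>i\<in>UNIV. \<Sum>j\<in>UNIV. X x $ i * partial i (\<lambda>y. Y y $ j) x * coord_deriv g Z j k x) +
    (\<Sum>i\<in>UNIV. \<Sum>j\<in>UNIV. X x $ i * Y x $ j *
      (partial i (coord_deriv g Z j k) x + (\<Sum>l\<in>UNIV. christoffel g k i l x * coord_deriv g Z j l x)))"
    unfolding cd by (simp add: distrib_left sum.distrib sum_distrib_left mult.assoc)
  also have "(\<Sum>i\<in>UNIV. \<Sum>j\<in>UNIV. X x $ i * partial i (\<lambda>y. Y y $ j) x * coord_deriv g Z j k x) =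
    (\<Sum>j\<in>UNIV. (\<Sum>i\<in>UNIV. X x $ i * partial i (\<lambda>y. Y y $ j) x) * coord_deriv g Z j k x)"
    by (subst sum.swap) (simp add: sum_distrib_right)
  finally show ?thesis .
qed

text \<open>
  The second partial derivatives of \<open>Z\<close> cancel by Schwarz' theorem, and the terms with first
  derivatives of \<open>Z\<close> are symmetric in \<open>i\<close> and \<open>j\<close>.
\<close>

lemma coord_deriv_commutator:
  assumes "smooth_on S Z" "x \<in> S"
  shows "(partial i (coord_deriv g Z j k) x + (\<Sum>l\<in>UNIV. christoffel g k i l x * coord_deriv g Z j l x))
    - (partial j (coord_deriv g Z i k) x + (\<Sum>l\<in>UNIV. christoffel g k j l x * coord_deriv g Z i l x))
    = (\<Sum>l\<in>UNIV. coord_curvature g k l i j x * Z x $ l)"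
proof -
  note df = smooth_on_differentiable[OF _ assms(2)]
  define z where "z l = (\<lambda>y. Z y $ l)" for l
  have z: "smooth_on S (z l)" for l
    using smooth_on_component[OF assms(1)] by (simp add: z_def)
  have Zz: "Z y $ l = z l y" for y l by (simp add: z_def)
  have cd: "coord_deriv g Z j k = (\<lambda>y. partial j (z k) y + (\<Sum>l\<in>UNIV. christoffel g k j l y * z l y))" for j k
    by (simp add: coord_deriv_def[abs_def] Zz)
  have p: "partial i (coord_deriv g Z j k) x = partial i (partial j (z k)) x +
      (\<Sum>l\<in>UNIV. partial i (christoffel g k j l) x * z l x + christoffel g k j l x * partial i (z l) x)" for i j
    unfolding cd
    by (simp add: partial_add partial_sum partial_mult differentiable_sum differentiable_mult df \<Gamma> z smooth_on_partial)
  have q: "(\<Sum>l\<in>UNIV. christoffel g k i l x * coord_deriv g Z j l x) =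
      (\<Sum>l\<in>UNIV. christoffel g k i l x * partial j (z l) x) +
      (\<Sum>l\<in>UNIV. (\<Sum>m\<in>UNIV. christoffel g k i m x * christoffel g m j l x) * z l x)" for i j
  proof -
    have "(\<Sum>m\<in>UNIV. christoffel g k i m x * (\<Sum>l\<in>UNIV. christoffel g m j l x * z l x)) =
        (\<Sum>l\<in>UNIV. (\<Sum>m\<in>UNIV. christoffel g k i m x * christoffel g m j l x) * z l x)"
      unfolding sum_distrib_left sum_distrib_right by (subst sum.swap) (simp add: mult.assoc)
    then show ?thesis unfolding cd by (simp add: distrib_left sum.distrib)
  qed
  show ?thesis
    unfolding p q coord_curvature_def Zz partial_commute[OF S z assms(2), of i j]
    by (simp add: sum.distrib sum_subtractf distrib_right left_diff_distrib)
qed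

lemma curvature_nth:
  assumes "smooth_on S X" "smooth_on S Y" "smooth_on S Z" "x \<in> S"
  shows "curvature g X Y Z x $ k =
    (\<Sum>i\<in>UNIV. \<Sum>j\<in>UNIV. X x $ i * Y x $ j * (\<Sum>l\<in>UNIV. coord_curvature g k l i j x * Z x $ l))"
proof -
  note df = smooth_on_differentiable[OF _ assms(4)]
  \<comment> \<open>The components of \<open>\<nabla>\<^sub>i \<nabla>\<^sub>j Z\<close>.\<close>
  define H where "H i j = partial i (coord_deriv g Z j k) x
    + (\<Sum>l\<in>UNIV. christoffel g k i l x * coord_deriv g Z j l x)" for i j
  have lb: "lie_bracket X Y x $ j = (\<Sum>i\<in>UNIV. X x $ i * partial i (\<lambda>y. Y y $ j) x)
     - (\<Sum>i\<in>UNIV. Y x $ i * partial i (\<lambda>y. X y $ j) x)" for j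
    by (simp add: lie_bracket_def frechet_derivative_vec_nth df assms frechet_derivative_eq_sum_partial smooth_on_component)
  have sw: "(\<Sum>i\<in>UNIV. \<Sum>j\<in>UNIV. Y x $ i * X x $ j * H i j) = (\<Sum>i\<in>UNIV. \<Sum>j\<in>UNIV. X x $ i * Y x $ j * H j i)"
    by (subst sum.swap) (simp add: mult.commute)
  have "curvature g X Y Z x $ k = (\<Sum>i\<in>UNIV. \<Sum>j\<in>UNIV. X x $ i * Y x $ j * H i j)
      - (\<Sum>i\<in>UNIV. \<Sum>j\<in>UNIV. X x $ i * Y x $ j * H j i)"
    unfolding curvature_def vector_minus_component
      second_cov_deriv_nth[OF assms] second_cov_deriv_nth[OF assms(2,1,3,4)]
      cov_deriv_nth[OF df[OF assms(3)]] lb H_def[symmetric] sw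
    by (simp add: left_diff_distrib sum_subtractf)
  also have "\<dots> = (\<Sum>i\<in>UNIV. \<Sum>j\<in>UNIV. X x $ i * Y x $ j * (H i j - H j i))"
    by (simp add: right_diff_distrib sum_subtractf)
  finally show ?thesis
    unfolding H_def coord_deriv_commutator[OF assms(3,4)] .
qed

lemma ricci_eq_coord:
  assumes "smooth_on S Y" "smooth_on S Z" "x \<in> S"
  shows "ricci g Y Z x = (\<Sum>j\<in>UNIV. \<Sum>k\<in>UNIV. coord_ricci g j k x * Y x $ j * Z x $ k)"
proof -
  have "ricci g Y Z x = (\<Sum>i\<in>UNIV. curvature g (\<lambda>_. axis i 1) Y Z x $ i)"
    by (simp add: ricci_def trace_def matrix_def)
  also have "\<dots> = (\<Sum>i\<in>UNIV. \<Sum>j\<in>UNIV. \<Sum>k\<in>UNIV. coord_curvature g i k i j x * Y x $ j * Z x $ k)"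
  proof (rule sum.cong[OF refl])
    fix i
    have "curvature g (\<lambda>_. axis i 1) Y Z x $ i = (\<Sum>i'\<in>UNIV. if i' = i then
        \<Sum>j\<in>UNIV. Y x $ j * (\<Sum>l\<in>UNIV. coord_curvature g i l i' j x * Z x $ l) else 0)"
      unfolding curvature_nth[OF smooth_on_const assms]
      by (intro sum.cong) (auto simp: axis_def)
    then show "curvature g (\<lambda>_. axis i 1) Y Z x $ i =
        (\<Sum>j\<in>UNIV. \<Sum>k\<in>UNIV. coord_curvature g i k i j x * Y x $ j * Z x $ k)"
      by (simp add: sum_distrib_left mult_ac)
  qed
  also have "\<dots> = (\<Sum>j\<in>UNIV. \<Sum>k\<in>UNIV. \<Sum>i\<in>UNIV. coord_curvature g i k i j x * Y x $ j * Z x $ k)"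
    by (rule trans[OF sum.swap], rule sum.cong[OF refl], rule sum.swap)
  finally show ?thesis by (simp add: coord_ricci_def sum_distrib_right)
qed

lemma smooth_on_coord_ricci: "smooth_on S (coord_ricci g j k)"
  unfolding coord_ricci_def[abs_def] coord_curvature_def[abs_def]
  by (intro smooth_on_sum smooth_on_add smooth_on_diff smooth_on_mult smooth_on_partial S \<Gamma>)

lemma cov_deriv_ricci_eq_coord:
  assumes "smooth_on S X" "smooth_on S Y" "smooth_on S Z" "x \<in> S"
  shows "cov_deriv_ricci g X Y Z x =
    (\<Sum>i\<in>UNIV. \<Sum>j\<in>UNIV. \<Sum>k\<in>UNIV. coord_deriv_ricci g i j k x * X x $ i * Y x $ j * Z x $ k)"
proof -
  note df = smooth_on_differentiable[OF _ assms(4)]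
  define y where "y j = (\<lambda>x. Y x $ j)" for j
  define z where "z j = (\<lambda>x. Z x $ j)" for j
  note yz = smooth_on_component[OF assms(2), folded y_def] smooth_on_component[OF assms(3), folded z_def]
  have Yy: "Y w $ l = y l w" "Z w $ l = z l w" for w l by (simp_all add: y_def z_def)
  let ?\<rho> = "\<lambda>j k. coord_ricci g j k x"
  have r: "ricci g Y Z w = (\<Sum>j\<in>UNIV. \<Sum>k\<in>UNIV. coord_ricci g j k w * y j w * z k w)" if "w \<in> S" for w
    using ricci_eq_coord[OF assms(2,3) that] by (simp add: Yy)
  have sr: "smooth_on S (ricci g Y Z)"
    by (subst smooth_on_cong[OF S r])
      (auto intro!: smooth_on_sum smooth_on_mult smooth_on_coord_ricci S yz)
  have p: "partial i (ricci g Y Z) x = (\<Sum>j\<in>UNIV. \<Sum>k\<in>UNIV. partial i (coord_ricci g j k) x * y j x * z k x)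
      + (\<Sum>j\<in>UNIV. \<Sum>k\<in>UNIV. ?\<rho> j k * partial i (y j) x * z k x)
      + (\<Sum>j\<in>UNIV. \<Sum>k\<in>UNIV. ?\<rho> j k * y j x * partial i (z k) x)" for i
    by (subst partial_cong_open[OF S assms(4) r])
      (simp_all add: partial_sum partial_mult differentiable_sum differentiable_mult df yz smooth_on_coord_ricci
        sum.distrib algebra_simps)
  have 1: "frechet_derivative (ricci g Y Z) (at x) (X x) = (\<Sum>i\<in>UNIV. X x $ i * partial i (ricci g Y Z) x)"
    by (rule frechet_derivative_eq_sum_partial[OF df[OF sr]])
  have 2: "ricci g (cov_deriv g X Y) Z x = (\<Sum>i\<in>UNIV. X x $ i *
      ((\<Sum>j\<in>UNIV. \<Sum>k\<in>UNIV. ?\<rho> j k * partial i (y j) x * z k x) +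
       (\<Sum>j\<in>UNIV. \<Sum>k\<in>UNIV. (\<Sum>m\<in>UNIV. christoffel g m i j x * ?\<rho> m k) * y j x * z k x)))"
    unfolding ricci_eq_coord[OF smooth_on_cov_deriv[OF assms(1,2)] assms(3,4)]
      cov_deriv_nth[OF df[OF assms(2)]] coord_deriv_def Yy
    by (rule bilinear_cov_deriv_sum)
  have 3: "ricci g Y (cov_deriv g X Z) x = (\<Sum>i\<in>UNIV. X x $ i *
      ((\<Sum>j\<in>UNIV. \<Sum>k\<in>UNIV. ?\<rho> j k * y j x * partial i (z k) x) +
       (\<Sum>j\<in>UNIV. \<Sum>k\<in>UNIV. (\<Sum>m\<in>UNIV. christoffel g m i k x * ?\<rho> j m) * y j x * z k x)))"
  proof -
    have "ricci g Y (cov_deriv g X Z) x =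
        (\<Sum>k\<in>UNIV. \<Sum>j\<in>UNIV. ?\<rho> j k * (\<Sum>i\<in>UNIV. X x $ i *
          (partial i (z k) x + (\<Sum>l\<in>UNIV. christoffel g k i l x * z l x))) * y j x)"
      unfolding ricci_eq_coord[OF assms(2) smooth_on_cov_deriv[OF assms(1,3)] assms(4)]
        cov_deriv_nth[OF df[OF assms(3)]] coord_deriv_def Yy
      by (subst sum.swap) (simp add: mult_ac)
    also have "\<dots> = (\<Sum>i\<in>UNIV. X x $ i *
      ((\<Sum>k\<in>UNIV. \<Sum>j\<in>UNIV. ?\<rho> j k * partial i (z k) x * y j x) +
       (\<Sum>k\<in>UNIV. \<Sum>j\<in>UNIV. (\<Sum>m\<in>UNIV. christoffel g m i k x * ?\<rho> j m) * z k x * y j x)))"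
      by (rule bilinear_cov_deriv_sum)
    also have "\<dots> = (\<Sum>i\<in>UNIV. X x $ i *
      ((\<Sum>j\<in>UNIV. \<Sum>k\<in>UNIV. ?\<rho> j k * partial i (z k) x * y j x) +
       (\<Sum>j\<in>UNIV. \<Sum>k\<in>UNIV. (\<Sum>m\<in>UNIV. christoffel g m i k x * ?\<rho> j m) * z k x * y j x)))"
      by (rule sum.cong[OF refl], rule arg_cong2[where f = "(*)"], rule refl,
          rule arg_cong2[where f = "(+)"]; rule sum.swap)
    finally show ?thesis by (simp only: mult_ac)
  qed
  have "cov_deriv_ricci g X Y Z x = (\<Sum>i\<in>UNIV. X x $ i *
     ((\<Sum>j\<in>UNIV. \<Sum>k\<in>UNIV. partial i (coord_ricci g j k) x * y j x * z k x)
       - (\<Sum>j\<in>UNIV. \<Sum>k\<in>UNIV. (\<Sum>m\<in>UNIV. christoffel g m i j x * ?\<rho> m k) * y j x * z k x)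
       - (\<Sum>j\<in>UNIV. \<Sum>k\<in>UNIV. (\<Sum>m\<in>UNIV. christoffel g m i k x * ?\<rho> j m) * y j x * z k x)))"
    unfolding cov_deriv_ricci_def 1 2 3 p
    by (simp add: distrib_left right_diff_distrib sum.distrib sum_subtractf)
  also have "\<dots> = (\<Sum>i\<in>UNIV. X x $ i * (\<Sum>j\<in>UNIV. \<Sum>k\<in>UNIV. coord_deriv_ricci g i j k x * y j x * z k x))"
    unfolding sum_subtractf[symmetric] left_diff_distrib[symmetric] coord_deriv_ricci_def ..
  finally show ?thesis
    by (simp add: Yy sum_distrib_left mult_ac)
qed

text \<open>
  By tensoriality it suffices to test the parallelism of the Ricci tensor on the coordinate fields.
\<close>

lemma parallel_ricci_on_iff_coord:
  "parallel_ricci_on S g \<longleftrightarrow> (\<forall>x\<in>S. \<forall>i j k. coord_deriv_ricci g i j k x = 0)"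
proof
  assume par: "parallel_ricci_on S g"
  show "\<forall>x\<in>S. \<forall>i j k. coord_deriv_ricci g i j k x = 0"
  proof (intro ballI allI)
    fix x i j k assume x: "x \<in> S"
    have "0 = cov_deriv_ricci g (\<lambda>_. axis i 1) (\<lambda>_. axis j 1) (\<lambda>_. axis k 1) x"
      using par x smooth_on_const unfolding parallel_ricci_on_def by metis
    also have "\<dots> = coord_deriv_ricci g i j k x"
      unfolding cov_deriv_ricci_eq_coord[OF smooth_on_const smooth_on_const smooth_on_const x]
      by (simp add: axis_def if_distrib[of "\<lambda>t. _ * t"] cong: if_cong)
    finally show "coord_deriv_ricci g i j k x = 0" by simp
  qed
next
  assume "\<forall>x\<in>S. \<forall>i j k. coord_deriv_ricci g i j k x = 0"
  then show "parallel_ricci_on S g"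
    by (simp add: parallel_ricci_on_def cov_deriv_ricci_eq_coord)
qed

end

section \<open>Functions of two variables\<close>

lemma smooth_on_D3: "smooth_on U f \<Longrightarrow> smooth_on U (D3 f)"
  using smooth_on_frechet_derivative[of U f "(1, 0)"] by (simp add: D3_def[abs_def])

lemma smooth_on_D4: "smooth_on U f \<Longrightarrow> smooth_on U (D4 f)"
  using smooth_on_frechet_derivative[of U f "(0, 1)"] by (simp add: D4_def[abs_def])

lemma D3_D4_commute:
  "open U \<Longrightarrow> smooth_on U f \<Longrightarrow> z \<in> U \<Longrightarrow> D3 (D4 f) z = D4 (D3 f) z"
  using smooth_on_second_derivative_symmetric[of U f z "(0, 1)" "(1, 0)"]
  by (simp add: D3_def[abs_def] D4_def[abs_def])

lemma D_eqI:
  assumes "(f has_derivative F) (at z)"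
  shows "D3 f z = F (1, 0)" "D4 f z = F (0, 1)"
  using frechet_derivative_apply[OF assms] by (simp_all add: D3_def D4_def)

lemma has_derivative_D:
  assumes "f differentiable (at z)"
  shows "(f has_derivative (\<lambda>v. fst v * D3 f z + snd v * D4 f z)) (at z)"
proof -
  have lin: "linear (frechet_derivative f (at z))"
    using assms by (rule linear_frechet_derivative)
  have "frechet_derivative f (at z) v = fst v * D3 f z + snd v * D4 f z" for v
    using linear_add[OF lin, of "fst v *\<^sub>R (1, 0)" "snd v *\<^sub>R (0, 1)"]
    by (simp add: linear_cmul[OF lin] D3_def D4_def del: scaleR_Pair) (simp add: scaleR_Pair)
  then have "frechet_derivative f (at z) = (\<lambda>v. fst v * D3 f z + snd v * D4 f z)" ..
  then show ?thesis using assms by (simp add: frechet_derivative_works)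
qed

lemma D_add:
  assumes "f differentiable (at z)" "g differentiable (at z)"
  shows "D3 (\<lambda>z. f z + g z) z = D3 f z + D3 g z" "D4 (\<lambda>z. f z + g z) z = D4 f z + D4 g z"
  using D_eqI[OF has_derivative_add[OF assms[THEN has_derivative_D]]] by simp_all

lemma D_diff:
  assumes "f differentiable (at z)" "g differentiable (at z)"
  shows "D3 (\<lambda>z. f z - g z) z = D3 f z - D3 g z" "D4 (\<lambda>z. f z - g z) z = D4 f z - D4 g z"
  using D_eqI[OF has_derivative_diff[OF assms[THEN has_derivative_D]]] by simp_all

lemma D_mult:
  assumes "f differentiable (at z)" "g differentiable (at z)"
  shows "D3 (\<lambda>z. f z * g z) z = f z * D3 g z + D3 f z * g z"
    "D4 (\<lambda>z. f z * g z) z = f z * D4 g z + D4 f z * g z"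
  using D_eqI[OF has_derivative_mult[OF assms[THEN has_derivative_D]]] by simp_all

lemma D_const: "D3 (\<lambda>_. r) z = 0" "D4 (\<lambda>_. r) z = 0"
  using D_eqI[OF has_derivative_const[of r "at z"]] by simp_all

lemma D_cmult:
  assumes "f differentiable (at z)"
  shows "D3 (\<lambda>z. r * f z) z = r * D3 f z" "D4 (\<lambda>z. r * f z) z = r * D4 f z"
  using D_mult[OF differentiable_const assms, of r] by (simp_all add: D_const)

lemma D_divide:
  assumes "f differentiable (at z)"
  shows "D3 (\<lambda>z. f z / r) z = D3 f z / r" "D4 (\<lambda>z. f z / r) z = D4 f z / r"
  using D_cmult[OF assms, of "1 / r"] by simp_all

lemma D_cong:
  assumes "open U" "z \<in> U" "\<And>w. w \<in> U \<Longrightarrow> f w = g w"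
  shows "D3 f z = D3 g z" "D4 f z = D4 g z"
proof -
  have "(f has_derivative F) (at z) \<longleftrightarrow> (g has_derivative F) (at z)" for F
    using has_derivative_transform_within_open[of f F z UNIV U g]
      has_derivative_transform_within_open[of g F z UNIV U f] assms by auto
  then show "D3 f z = D3 g z" "D4 f z = D4 g z"
    by (simp_all add: D3_def D4_def frechet_derivative_def)
qed

lemma D_coordinates:
  "D3 fst z = 1" "D4 fst z = 0" "D3 snd z = 0" "D4 snd z = 1"
  using D_eqI[OF bounded_linear_imp_has_derivative[OF bounded_linear_fst], of z]
    D_eqI[OF bounded_linear_imp_has_derivative[OF bounded_linear_snd], of z]
  by simp_all

text \<open>
  No regularity of \<open>k\<close> is needed here (nor of \<open>l\<close> below): only the restriction of \<open>f\<close> to a coordinate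
  line, where \<open>f\<close> is locally constant, is differentiated.
\<close>

lemma D3_comp_snd:
  assumes "f differentiable (at z)" "open U" "z \<in> U" "\<And>w. w \<in> U \<Longrightarrow> f w = k (snd w)"
  shows "D3 f z = 0"
proof -
  have line: "((\<lambda>t. (fst z + t, snd z)) has_derivative (\<lambda>t. (t, 0))) (at 0)"
    by (auto intro!: derivative_eq_intros)
  have "((\<lambda>t. f (fst z + t, snd z)) has_derivative (\<lambda>t. t * D3 f z)) (at 0)"
    using has_derivative_compose[OF line, of f "\<lambda>v. fst v * D3 f z + snd v * D4 f z"]
      has_derivative_D[OF assms(1)] by simp
  moreover have "((\<lambda>t. f (fst z + t, snd z)) has_derivative (\<lambda>_. 0)) (at 0)"
  proof (rule has_derivative_transform_within_open)
    show "((\<lambda>t. k (snd z)) has_derivative (\<lambda>_. 0)) (at 0)" by simp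
    show "open ((\<lambda>t. (fst z + t, snd z)) -` U)"
      by (intro open_vimage \<open>open U\<close> continuous_intros)
  qed (use assms in auto)
  ultimately have "(\<lambda>t. t * D3 f z) = (\<lambda>_. 0)"
    by (rule has_derivative_unique)
  then show ?thesis by (metis mult_1)
qed

lemma D4_comp_fst:
  assumes "f differentiable (at z)" "open U" "z \<in> U" "\<And>w. w \<in> U \<Longrightarrow> f w = l (fst w)"
  shows "D4 f z = 0"
proof -
  have line: "((\<lambda>t. (fst z, snd z + t)) has_derivative (\<lambda>t. (0, t))) (at 0)"
    by (auto intro!: derivative_eq_intros)
  have "((\<lambda>t. f (fst z, snd z + t)) has_derivative (\<lambda>t. t * D4 f z)) (at 0)"
    using has_derivative_compose[OF line, of f "\<lambda>v. fst v * D3 f z + snd v * D4 f z"]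
      has_derivative_D[OF assms(1)] by simp
  moreover have "((\<lambda>t. f (fst z, snd z + t)) has_derivative (\<lambda>_. 0)) (at 0)"
  proof (rule has_derivative_transform_within_open)
    show "((\<lambda>t. l (fst z)) has_derivative (\<lambda>_. 0)) (at 0)" by simp
    show "open ((\<lambda>t. (fst z, snd z + t)) -` U)"
      by (intro open_vimage \<open>open U\<close> continuous_intros)
  qed (use assms in auto)
  ultimately have "(\<lambda>t. t * D4 f z) = (\<lambda>_. 0)"
    by (rule has_derivative_unique)
  then show ?thesis by (metis mult_1)
qed

section \<open>Global separation of variables on connected domains\<close>

lemma constant_if_D_zero:
  assumes "open U" "connected U" "\<And>z. z \<in> U \<Longrightarrow> f differentiable (at z)"
    and "\<And>z. z \<in> U \<Longrightarrow> D3 f z = 0" "\<And>z. z \<in> U \<Longrightarrow> D4 f z = 0"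
  shows "\<exists>\<kappa>. \<forall>z\<in>U. f z = \<kappa>"
proof (cases "U = {}")
  case False
  then obtain w where w: "w \<in> U" by blast
  have "(f has_derivative (\<lambda>_. 0)) (at z)" if "z \<in> U" for z
    using has_derivative_D[OF assms(3)[OF that]] assms(4,5)[OF that] by simp
  then have d: "(f has_derivative (\<lambda>_. 0)) (at z within U)" if "z \<in> U" for z
    using that has_derivative_at_withinI by blast
  have "continuous_on U f"
    using assms(3) by (intro continuous_at_imp_continuous_on) (auto intro: differentiable_imp_continuous_within)
  then have "f z = f w" if "z \<in> U" for z
    using has_derivative_zero_unique_strong_connected[OF assms(2,1) finite.emptyI _ w refl _ that] d by auto
  then show ?thesis by blast
qed auto

text \<open>
  A function with \<open>D3 f = 0\<close> depends on the second coordinate only locally: when a horizontal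
  slice of \<open>U\<close> is disconnected, it may take different values on the pieces. If its second derivative is a constant,
  then two integrations over the connected set \<open>U\<close> make it one quadratic polynomial on all of \<open>U\<close>.
\<close>

lemma polynomial_in_snd:
  assumes U: "open U" "connected U" and f: "smooth_on U f"
    and "\<And>z. z \<in> U \<Longrightarrow> D3 f z = 0" "\<And>z. z \<in> U \<Longrightarrow> D4 (D4 f) z = \<alpha>"
  shows "\<exists>\<beta> \<gamma>. \<forall>z\<in>U. f z = \<alpha> / 2 * (snd z)\<^sup>2 + \<beta> * snd z + \<gamma>"
proof -
  note df = smooth_on_differentiable[OF f] smooth_on_differentiable[OF smooth_on_D4[OF f]]
  have ds: "snd differentiable (at z)" for z :: "real \<times> real"
    by (intro bounded_linear_imp_differentiable bounded_linear_snd)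
  have "D3 (D4 f) z = 0" if "z \<in> U" for z
    using D3_D4_commute[OF U(1) f that] D_cong(2)[OF U(1) that, of "D3 f" "\<lambda>_. 0"] assms(4)
    by (simp add: D_const)
  then have "\<exists>\<beta>. \<forall>z\<in>U. D4 f z - \<alpha> * snd z = \<beta>"
    using assms(5)
    by (intro constant_if_D_zero U) (simp_all add: D_diff D_cmult D_coordinates df ds)
  then obtain \<beta> where \<beta>: "\<And>z. z \<in> U \<Longrightarrow> D4 f z = \<alpha> * snd z + \<beta>"
    by (auto simp: algebra_simps)
  have "\<exists>\<gamma>. \<forall>z\<in>U. f z - (\<alpha> / 2 * (snd z * snd z) + \<beta> * snd z) = \<gamma>"
    using assms(4) \<beta>
    by (intro constant_if_D_zero U)
      (simp_all add: D_diff D_add D_cmult D_divide D_mult D_coordinates df ds differentiable_mult)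
  then show ?thesis by (metis diff_eq_eq add.commute power2_eq_square)
qed

lemma polynomial_in_fst:
  assumes U: "open U" "connected U" and f: "smooth_on U f"
    and "\<And>z. z \<in> U \<Longrightarrow> D4 f z = 0" "\<And>z. z \<in> U \<Longrightarrow> D3 (D3 f) z = \<alpha>"
  shows "\<exists>\<beta> \<gamma>. \<forall>z\<in>U. f z = \<alpha> / 2 * (fst z)\<^sup>2 + \<beta> * fst z + \<gamma>"
proof -
  note df = smooth_on_differentiable[OF f] smooth_on_differentiable[OF smooth_on_D3[OF f]]
  have ds: "fst differentiable (at z)" for z :: "real \<times> real"
    by (intro bounded_linear_imp_differentiable bounded_linear_fst)
  have "D4 (D3 f) z = 0" if "z \<in> U" for z
    using D3_D4_commute[OF U(1) f that] D_cong(1)[OF U(1) that, of "D4 f" "\<lambda>_. 0"] assms(4)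
    by (simp add: D_const)
  then have "\<exists>\<beta>. \<forall>z\<in>U. D3 f z - \<alpha> * fst z = \<beta>"
    using assms(5)
    by (intro constant_if_D_zero U) (simp_all add: D_diff D_cmult D_coordinates df ds)
  then obtain \<beta> where \<beta>: "\<And>z. z \<in> U \<Longrightarrow> D3 f z = \<alpha> * fst z + \<beta>"
    by (auto simp: algebra_simps)
  have "\<exists>\<gamma>. \<forall>z\<in>U. f z - (\<alpha> / 2 * (fst z * fst z) + \<beta> * fst z) = \<gamma>"
    using assms(4) \<beta>
    by (intro constant_if_D_zero U)
      (simp_all add: D_diff D_add D_cmult D_divide D_mult D_coordinates df ds differentiable_mult)
  then show ?thesis by (metis diff_eq_eq add.commute power2_eq_square)
qed

text \<open>
  For a parallel Ricci tensor the hypotheses hold with \<open>p = 2 \<rho>\<^sub>4\<^sub>4\<close>, \<open>q = 2 \<rho>\<^sub>3\<^sub>3\<close> and \<open>s = \<rho>\<^sub>3\<^sub>4\<close>, because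
  \<open>\<Gamma>\<^sup>m\<^sub>3\<^sub>3 = \<Gamma>\<^sup>m\<^sub>4\<^sub>4\<close> and \<open>\<Gamma>\<^sup>m\<^sub>3\<^sub>4 = 0\<close> for \<open>m = 3, 4\<close>. They imply that
  \<open>D4 (D4 p) = 4 * D3 (D4 s) = D3 (D3 q)\<close>. The left-hand side is annihilated by \<open>D3\<close> and the
  right-hand side by \<open>D4\<close>, so both are one constant.
\<close>

lemma global_separation:
  assumes U: "open U" "connected U"
    and p: "smooth_on U p" and q: "smooth_on U q" and s: "smooth_on U s"
    and p3: "\<And>z. z \<in> U \<Longrightarrow> D3 p z = 0" and q4: "\<And>z. z \<in> U \<Longrightarrow> D4 q z = 0"
    and p4: "\<And>z. z \<in> U \<Longrightarrow> D4 p z = 4 * D3 s z" and q3: "\<And>z. z \<in> U \<Longrightarrow> D3 q z = 4 * D4 s z"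
  shows "\<exists>k l. \<forall>z\<in>U. p z = k (snd z) \<and> q z = l (fst z)"
proof -
  note sm = smooth_on_D3 smooth_on_D4
  note df = smooth_on_differentiable
  have p44: "D4 (D4 p) z = 4 * D4 (D3 s) z" if "z \<in> U" for z
    using D_cong(2)[OF U(1) that p4] df[OF sm(1)[OF s] that] by (simp add: D_cmult)
  have q33: "D3 (D3 q) z = D4 (D4 p) z" if "z \<in> U" for z
    using D_cong(1)[OF U(1) that q3] df[OF sm(2)[OF s] that] D3_D4_commute[OF U(1) s that] p44[OF that]
    by (simp add: D_cmult)
  have "D3 (D4 (D4 p)) z = 0" if "z \<in> U" for z
  proof -
    have p34: "D3 (D4 p) w = 0" if "w \<in> U" for w
      using D3_D4_commute[OF U(1) p that] D_cong(2)[OF U(1) that, of "D3 p" "\<lambda>_. 0"] p3 by (simp add: D_const)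
    show ?thesis
      using D3_D4_commute[OF U(1) sm(2)[OF p] that]
        D_cong(2)[OF U(1) that, of "D3 (D4 p)" "\<lambda>_. 0"] p34 by (simp add: D_const)
  qed
  moreover have "D4 (D4 (D4 p)) z = 0" if "z \<in> U" for z
  proof -
    have q43: "D4 (D3 q) w = 0" if "w \<in> U" for w
      using D3_D4_commute[OF U(1) q that] D_cong(1)[OF U(1) that, of "D4 q" "\<lambda>_. 0"] q4 by (simp add: D_const)
    have "D4 (D4 (D4 p)) z = D4 (D3 (D3 q)) z"
      by (rule D_cong(2)[OF U(1) that]) (simp add: q33)
    then show ?thesis
      using D3_D4_commute[OF U(1) sm(1)[OF q] that]
        D_cong(1)[OF U(1) that, of "D4 (D3 q)" "\<lambda>_. 0"] q43 by (simp add: D_const)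
  qed
  ultimately obtain \<alpha> where \<alpha>: "\<And>z. z \<in> U \<Longrightarrow> D4 (D4 p) z = \<alpha>"
    using constant_if_D_zero[OF U df[OF sm(2)[OF sm(2)[OF p]]]] by blast
  obtain \<beta> \<gamma> where "\<forall>z\<in>U. p z = \<alpha> / 2 * (snd z)\<^sup>2 + \<beta> * snd z + \<gamma>"
    using polynomial_in_snd[OF U p p3 \<alpha>] by blast
  moreover obtain \<beta>' \<gamma>' where "\<forall>z\<in>U. q z = \<alpha> / 2 * (fst z)\<^sup>2 + \<beta>' * fst z + \<gamma>'"
    using polynomial_in_fst[OF U q q4, of \<alpha>] q33 \<alpha> by auto
  ultimately show ?thesis
    by (intro exI[of _ "\<lambda>t. \<alpha> / 2 * t\<^sup>2 + \<beta> * t + \<gamma>"] exI[of _ "\<lambda>t. \<alpha> / 2 * t\<^sup>2 + \<beta>' * t + \<gamma>'"]) simp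
qed

section \<open>The system for the coefficients\<close>

text \<open>
  The system without the auxiliary functions \<open>k\<close> and \<open>l\<close>: its first two equations are half
  the derivatives of the equations with \<open>k\<close> and \<open>l\<close>, with respect to the first and second coordinate
  respectively. All conditions are pointwise.
\<close>

definition coefficient_system ::
  "(real \<times> real \<Rightarrow> real) \<Rightarrow> (real \<times> real \<Rightarrow> real) \<Rightarrow> (real \<times> real) set \<Rightarrow> bool" where
  "coefficient_system b c U \<longleftrightarrow> (\<forall>p \<in> U.
     b p * D3 b p = D3 (D3 b) p \<and>
     c p * D4 c p = D4 (D4 c) p \<and>
     3 * c p * D3 c p - 2 * D3 (D4 c) p - 2 * b p * D4 c p + D4 b p * c p = 0 \<and>
     4 * c p * D3 b p + b p * D3 c p - 2 * D3 (D4 b) p - 2 * D3 (D3 c) p - b p * D4 b p = 0 \<and>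
     c p * D4 b p + 4 * b p * D4 c p - 2 * D4 (D4 b) p - 2 * D3 (D4 c) p - c p * D3 c p = 0 \<and>
     3 * b p * D4 b p - 2 * D3 (D4 b) p + b p * D3 c p - 2 * c p * D3 b p = 0)"

lemma parallel_system_imp_coefficient_system:
  assumes "open (proj34 ` S)" "smooth_on (proj34 ` S) b" "smooth_on (proj34 ` S) c"
    and sys: "parallel_system b c k l S"
  shows "coefficient_system b c (proj34 ` S)"
  unfolding coefficient_system_def
proof
  fix z assume z: "z \<in> proj34 ` S"
  note sm = assms(2,3) smooth_on_D3[OF assms(2)] smooth_on_D4[OF assms(3)]
  note df = sm[THEN smooth_on_differentiable, OF z]
  have "D3 (\<lambda>z. b z * b z - 2 * D3 b z) z = 0"
    using sys
    by (intro D3_comp_snd[OF _ assms(1) z, of _ k]) (auto simp: parallel_system_def power2_eq_square df)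
  then have "b z * D3 b z = D3 (D3 b) z"
    by (simp add: D_diff D_mult D_cmult D_const df)
  moreover have "D4 (\<lambda>z. c z * c z - 2 * D4 c z) z = 0"
    using sys
    by (intro D4_comp_fst[OF _ assms(1) z, of _ l]) (auto simp: parallel_system_def power2_eq_square df)
  then have "c z * D4 c z = D4 (D4 c) z"
    by (simp add: D_diff D_mult D_cmult D_const df)
  moreover note sys[unfolded parallel_system_def, rule_format, OF z]
  ultimately show "b z * D3 b z = D3 (D3 b) z \<and>
     c z * D4 c z = D4 (D4 c) z \<and>
     3 * c z * D3 c z - 2 * D3 (D4 c) z - 2 * b z * D4 c z + D4 b z * c z = 0 \<and>
     4 * c z * D3 b z + b z * D3 c z - 2 * D3 (D4 b) z - 2 * D3 (D3 c) z - b z * D4 b z = 0 \<and>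
     c z * D4 b z + 4 * b z * D4 c z - 2 * D4 (D4 b) z - 2 * D3 (D4 c) z - c z * D3 c z = 0 \<and>
     3 * b z * D4 b z - 2 * D3 (D4 b) z + b z * D3 c z - 2 * c z * D3 b z = 0"
    by blast
qed

lemma coefficient_system_imp_parallel_system:
  assumes U: "open (proj34 ` S)" "connected (proj34 ` S)"
    and b: "smooth_on (proj34 ` S) b" and c: "smooth_on (proj34 ` S) c"
    and sys: "coefficient_system b c (proj34 ` S)"
  shows "\<exists>k l. parallel_system b c k l S"
proof -
  let ?U = "proj34 ` S"
  \<comment> \<open>\<open>?p\<close> and \<open>?q\<close> are \<open>2 \<rho>\<^sub>4\<^sub>4\<close> and \<open>2 \<rho>\<^sub>3\<^sub>3\<close>, and \<open>?s\<close> is \<open>\<rho>\<^sub>3\<^sub>4\<close>.\<close>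
  let ?p = "\<lambda>z. b z * b z - 2 * D3 b z" and ?q = "\<lambda>z. c z * c z - 2 * D4 c z"
  let ?s = "\<lambda>z. (D4 b z + D3 c z - b z * c z) / 2"
  note sm = b c smooth_on_D3[OF b] smooth_on_D4[OF b] smooth_on_D3[OF c] smooth_on_D4[OF c]
  note df = sm[THEN smooth_on_differentiable]
  note cl = smooth_on_add smooth_on_diff smooth_on_mult smooth_on_divide_const
  note comm = D3_D4_commute[OF U(1) b] D3_D4_commute[OF U(1) c]
  note sys' = sys[unfolded coefficient_system_def, rule_format]
  have "\<exists>k l. \<forall>z\<in>?U. ?p z = k (snd z) \<and> ?q z = l (fst z)"
  proof (rule global_separation[OF U])
    show "smooth_on ?U ?p" "smooth_on ?U ?q" "smooth_on ?U ?s"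
      by (intro cl U sm smooth_on_const)+
  next
    fix z assume z: "z \<in> ?U"
    note sz = sys'[OF z]
    show "D3 ?p z = 0" "D4 ?q z = 0"
      using sz by (simp_all add: D_diff D_mult D_cmult D_const df[OF z] mult.commute)
    have "D4 ?p z = 2 * (b z * D4 b z) - 2 * D3 (D4 b) z"
      "D3 ?q z = 2 * (c z * D3 c z) - 2 * D3 (D4 c) z"
      "D3 ?s z = (D3 (D4 b) z + D3 (D3 c) z - (b z * D3 c z + D3 b z * c z)) / 2"
      "D4 ?s z = (D4 (D4 b) z + D3 (D4 c) z - (b z * D4 c z + D4 b z * c z)) / 2"
      by (simp_all add: D_diff D_add D_mult D_cmult D_divide D_const df[OF z] comm[OF z])
    then show "D4 ?p z = 4 * D3 ?s z" "D3 ?q z = 4 * D4 ?s z"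
      using sz by (auto simp: algebra_simps)
  qed
  then obtain k l where "\<forall>z\<in>?U. ?p z = k (snd z) \<and> ?q z = l (fst z)" by blast
  then have "parallel_system b c k l S"
    using sys unfolding parallel_system_def coefficient_system_def
    by (simp add: power2_eq_square algebra_simps)
  then show ?thesis by blast
qed

section \<open>The projection to the plane of the last two coordinates\<close>

lemma bounded_linear_proj34: "bounded_linear proj34"
  unfolding proj34_def[abs_def] by (intro bounded_linear_Pair bounded_linear_vec_nth)

lemma open_proj34_image: "open S \<Longrightarrow> open (proj34 ` S)"
proof (rule open_surjective_linear_image)
  show "linear proj34" using bounded_linear_proj34 by (rule bounded_linear.linear)
  show "surj proj34"
  proof (rule surjI)
    show "proj34 (\<chi> i. if i = 3 then fst z else snd z) = z" for z
      by (simp add: proj34_def)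
  qed
qed

lemma connected_proj34_image: "connected S \<Longrightarrow> connected (proj34 ` S)"
  by (intro connected_continuous_image linear_continuous_on bounded_linear_proj34)

lemma has_derivative_comp_proj34:
  assumes "F differentiable (at (proj34 x))"
  shows "((\<lambda>y. F (proj34 y)) has_derivative
    (\<lambda>v. v $ 3 * D3 F (proj34 x) + v $ 4 * D4 F (proj34 x))) (at x)"
  using has_derivative_compose[OF bounded_linear_imp_has_derivative[OF bounded_linear_proj34]
      has_derivative_D[OF assms]]
  by (simp add: proj34_def)

lemma partial_comp_proj34:
  assumes "F differentiable (at (proj34 x))"
  shows "partial 1 (\<lambda>y. F (proj34 y)) x = 0" "partial 2 (\<lambda>y. F (proj34 y)) x = 0"
    "partial 3 (\<lambda>y. F (proj34 y)) x = D3 F (proj34 x)" "partial 4 (\<lambda>y. F (proj34 y)) x = D4 F (proj34 x)"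
  unfolding partial_def frechet_derivative_apply[OF has_derivative_comp_proj34[OF assms]]
  by (simp_all add: axis_def)

text \<open>
  Functions on \<open>\<real>\<^sup>4\<close> that are affine along the fibres of \<open>proj34\<close>, given by their coefficients. The
  function \<open>a\<close> of the theorem and its partial derivatives are of this form.
\<close>

definition fibre_affine ::
  "(real \<times> real \<Rightarrow> real) \<Rightarrow> (real \<times> real \<Rightarrow> real) \<Rightarrow> (real \<times> real \<Rightarrow> real) \<Rightarrow> real^4 \<Rightarrow> real" where
  "fibre_affine F H E x = x $ 1 * F (proj34 x) + x $ 2 * H (proj34 x) + E (proj34 x)"

lemma partial_fibre_affine:
  assumes "F differentiable (at (proj34 x))" "H differentiable (at (proj34 x))"
    "E differentiable (at (proj34 x))"
  shows "partial 1 (fibre_affine F H E) x = F (proj34 x)"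
    "partial 2 (fibre_affine F H E) x = H (proj34 x)"
    "partial 3 (fibre_affine F H E) x = fibre_affine (D3 F) (D3 H) (D3 E) x"
    "partial 4 (fibre_affine F H E) x = fibre_affine (D4 F) (D4 H) (D4 E) x"
proof -
  have "(fibre_affine F H E has_derivative (\<lambda>v.
      (x $ 1 * (v $ 3 * D3 F (proj34 x) + v $ 4 * D4 F (proj34 x)) + v $ 1 * F (proj34 x)) +
      (x $ 2 * (v $ 3 * D3 H (proj34 x) + v $ 4 * D4 H (proj34 x)) + v $ 2 * H (proj34 x)) +
      (v $ 3 * D3 E (proj34 x) + v $ 4 * D4 E (proj34 x)))) (at x)"
    unfolding fibre_affine_def[abs_def]
    by (intro has_derivative_add has_derivative_mult has_derivative_comp_proj34 assms
        bounded_linear_imp_has_derivative bounded_linear_vec_nth)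
  note d = frechet_derivative_apply[OF this]
  show "partial 1 (fibre_affine F H E) x = F (proj34 x)"
    "partial 2 (fibre_affine F H E) x = H (proj34 x)"
    "partial 3 (fibre_affine F H E) x = fibre_affine (D3 F) (D3 H) (D3 E) x"
    "partial 4 (fibre_affine F H E) x = fibre_affine (D4 F) (D4 H) (D4 E) x"
    unfolding partial_def d by (simp_all add: axis_def fibre_affine_def)
qed

lemma smooth_on_fibre_affine:
  assumes "open S" "smooth_on (proj34 ` S) F" "smooth_on (proj34 ` S) H" "smooth_on (proj34 ` S) E"
  shows "smooth_on S (fibre_affine F H E)"
  unfolding fibre_affine_def[abs_def]
  by (intro smooth_on_add smooth_on_mult smooth_on_linear[OF _ bounded_linear_vec_nth]
      smooth_on_compose_linear_right[OF _ bounded_linear_proj34 order_refl] assms)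

section \<open>The Ricci tensor of the Walker metric and its derivative\<close>

lemma matrix_inv_eqI:
  assumes "A ** B = mat 1" "B ** A = mat 1"
  shows "matrix_inv A = B"
proof -
  have "A ** matrix_inv A = mat 1"
    unfolding matrix_inv_def by (rule someI2[of _ B]) (use assms in auto)
  then have "B ** (A ** matrix_inv A) = B" by simp
  then show ?thesis by (simp add: matrix_mul_assoc assms)
qed

lemma matrix_inv_walker:
  "matrix_inv (walker_metric a x) = (\<chi> i j.
     if (i, j) \<in> {(1, 3), (3, 1), (2, 4), (4, 2)} then 1
     else if (i, j) \<in> {(1, 1), (2, 2)} then - a x else 0)" (is "_ = ?h")
proof -
  have "walker_metric a x ** ?h = mat 1" "?h ** walker_metric a x = mat 1"
    by (simp_all add: vec_eq_iff forall_4 matrix_matrix_mult_def sum_4 mat_def walker_metric_def)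
  then show ?thesis by (rule matrix_inv_eqI)
qed

text \<open>
  The table of the Christoffel symbols \<open>\<Gamma>\<^sup>k\<^sub>i\<^sub>j\<close>, as functions of the values of \<open>a\<close> and of its four partial
  derivatives at a point.
\<close>

definition walker_gamma ::
  "real \<Rightarrow> real \<Rightarrow> real \<Rightarrow> real \<Rightarrow> real \<Rightarrow> 4 \<Rightarrow> 4 \<Rightarrow> 4 \<Rightarrow> real" where
  "walker_gamma a a1 a2 a3 a4 k i j =
    (if (k, i, j) \<in> {(1, 1, 3), (1, 3, 1), (2, 1, 4), (2, 4, 1)} then a1 / 2
     else if (k, i, j) \<in> {(1, 2, 3), (1, 3, 2), (2, 2, 4), (2, 4, 2)} then a2 / 2
     else if (k, i, j) \<in> {(3, 3, 3), (3, 4, 4)} then - a1 / 2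
     else if (k, i, j) \<in> {(4, 3, 3), (4, 4, 4)} then - a2 / 2
     else if (k, i, j) = (1, 3, 3) then (a * a1 + a3) / 2
     else if (k, i, j) = (1, 4, 4) then (a * a1 - a3) / 2
     else if (k, i, j) = (2, 3, 3) then (a * a2 - a4) / 2
     else if (k, i, j) = (2, 4, 4) then (a * a2 + a4) / 2
     else if (k, i, j) \<in> {(1, 3, 4), (1, 4, 3)} then a4 / 2
     else if (k, i, j) \<in> {(2, 3, 4), (2, 4, 3)} then a3 / 2
     else 0)"

lemma partial_walker_metric:
  "partial i (\<lambda>y. walker_metric a y $ j $ l) x = (if (j, l) \<in> {(3, 3), (4, 4)} then partial i a x else 0)"
proof (cases "(j, l) \<in> {(3, 3), (4, 4)}")
  case True
  then have "(j, l) \<notin> {(1, 3), (3, 1), (2, 4), (4, 2)}" by auto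
  with True show ?thesis by (simp only: walker_metric_def vec_lambda_beta if_True if_False)
next
  case False
  then show ?thesis
    by (cases "(j, l) \<in> {(1, 3), (3, 1), (2, 4), (4, 2)}")
      (simp_all only: walker_metric_def vec_lambda_beta if_True if_False partial_const)
qed

lemma christoffel_walker:
  "christoffel (walker_metric a) k i j x =
    walker_gamma (a x) (partial 1 a x) (partial 2 a x) (partial 3 a x) (partial 4 a x) k i j"
proof -
  have "\<forall>k i j. christoffel (walker_metric a) k i j x =
    walker_gamma (a x) (partial 1 a x) (partial 2 a x) (partial 3 a x) (partial 4 a x) k i j"
    unfolding forall_4
    by (simp add: christoffel_def sum_4 partial_walker_metric matrix_inv_walker walker_gamma_def
        algebra_simps add_divide_distrib diff_divide_distrib)
  then show ?thesis by blast
qed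

text \<open>
  The table of the components of the Ricci tensor; they are functions on the plane.
\<close>

definition walker_ricci :: "(real \<times> real \<Rightarrow> real) \<Rightarrow> (real \<times> real \<Rightarrow> real) \<Rightarrow> 4 \<Rightarrow> 4 \<Rightarrow> real \<times> real \<Rightarrow> real" where
  "walker_ricci b c j k =
    (if (j, k) = (3, 3) then (\<lambda>z. c z * c z / 2 - D4 c z)
     else if (j, k) \<in> {(3, 4), (4, 3)} then (\<lambda>z. (D4 b z + D3 c z - b z * c z) / 2)
     else if (j, k) = (4, 4) then (\<lambda>z. b z * b z / 2 - D3 b z)
     else (\<lambda>_. 0))"

text \<open>
  The table of the components of the covariant derivative of the Ricci tensor. Up to non-zero
  factors the non-zero entries are the left-hand sides of the equations of \<open>coefficient_system\<close>.
\<close>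

definition walker_deriv_ricci ::
  "(real \<times> real \<Rightarrow> real) \<Rightarrow> (real \<times> real \<Rightarrow> real) \<Rightarrow> 4 \<Rightarrow> 4 \<Rightarrow> 4 \<Rightarrow> real \<times> real \<Rightarrow> real" where
  "walker_deriv_ricci b c i j k z =
    (if (i, j, k) = (3, 3, 3) then
       (3 * c z * D3 c z - 2 * D3 (D4 c) z - 2 * b z * D4 c z + D4 b z * c z) / 2
     else if (i, j, k) \<in> {(3, 3, 4), (3, 4, 3)} then
       - (4 * c z * D3 b z + b z * D3 c z - 2 * D3 (D4 b) z - 2 * D3 (D3 c) z - b z * D4 b z) / 4
     else if (i, j, k) = (3, 4, 4) then b z * D3 b z - D3 (D3 b) z
     else if (i, j, k) = (4, 3, 3) then c z * D4 c z - D4 (D4 c) z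
     else if (i, j, k) \<in> {(4, 3, 4), (4, 4, 3)} then
       - (c z * D4 b z + 4 * b z * D4 c z - 2 * D4 (D4 b) z - 2 * D3 (D4 c) z - c z * D3 c z) / 4
     else if (i, j, k) = (4, 4, 4) then
       (3 * b z * D4 b z - 2 * D3 (D4 b) z + b z * D3 c z - 2 * c z * D3 b z) / 2
     else 0)"

lemma coefficient_system_iff_walker_deriv_ricci:
  "coefficient_system b c U \<longleftrightarrow> (\<forall>z\<in>U. \<forall>i j k. walker_deriv_ricci b c i j k z = 0)"
  unfolding coefficient_system_def forall_4
  by (intro ball_cong refl) (auto simp: walker_deriv_ricci_def)

context
  fixes \<Omega> :: "(real^4) set" and a :: "real^4 \<Rightarrow> real" and b c d :: "real \<times> real \<Rightarrow> real"
  assumes \<Omega>: "open \<Omega>"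
    and b: "smooth_on (proj34 ` \<Omega>) b" and c: "smooth_on (proj34 ` \<Omega>) c" and d: "smooth_on (proj34 ` \<Omega>) d"
    and a: "\<And>x. x \<in> \<Omega> \<Longrightarrow> a x = x $ 1 * b (x $ 3, x $ 4) + x $ 2 * c (x $ 3, x $ 4) + d (x $ 3, x $ 4)"
begin

text \<open>
  The function \<open>a\<close> and its partial derivatives \<open>a\<^sub>3\<close>, \<open>a\<^sub>4\<close>, \<open>a\<^sub>1\<close>, \<open>a\<^sub>2\<close> agree on \<open>\<Omega>\<close> with \<open>\<alpha>\<close>, \<open>\<alpha>3\<close>, \<open>\<alpha>4\<close>, \<open>\<beta>\<close>, \<open>\<gamma>\<close>
  respectively.
\<close>

private definition "\<alpha> = fibre_affine b c d"
private definition "\<alpha>3 = fibre_affine (D3 b) (D3 c) (D3 d)"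
private definition "\<alpha>4 = fibre_affine (D4 b) (D4 c) (D4 d)"
private definition "\<beta> x = b (proj34 x)"
private definition "\<gamma> x = c (proj34 x)"

private lemmas sm0 = b c d smooth_on_D3[OF b] smooth_on_D3[OF c] smooth_on_D3[OF d]
  smooth_on_D4[OF b] smooth_on_D4[OF c] smooth_on_D4[OF d]

private lemma smooth_parts:
  "smooth_on \<Omega> \<alpha>" "smooth_on \<Omega> \<alpha>3" "smooth_on \<Omega> \<alpha>4" "smooth_on \<Omega> \<beta>" "smooth_on \<Omega> \<gamma>"
  unfolding \<alpha>_def \<alpha>3_def \<alpha>4_def \<beta>_def[abs_def] \<gamma>_def[abs_def]
  by (intro smooth_on_fibre_affine sm0 \<Omega>
      smooth_on_compose_linear_right[OF _ bounded_linear_proj34 order_refl])+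

private lemma diff_base: "x \<in> \<Omega> \<Longrightarrow> smooth_on (proj34 ` \<Omega>) f \<Longrightarrow> f differentiable (at (proj34 x))"
  by (rule smooth_on_differentiable) auto

private lemma partial_parts:
  assumes x: "x \<in> \<Omega>"
  shows "partial 1 \<alpha> x = \<beta> x" "partial 2 \<alpha> x = \<gamma> x" "partial 3 \<alpha> x = \<alpha>3 x" "partial 4 \<alpha> x = \<alpha>4 x"
    "partial 1 \<beta> x = 0" "partial 2 \<beta> x = 0" "partial 3 \<beta> x = D3 b (proj34 x)" "partial 4 \<beta> x = D4 b (proj34 x)"
    "partial 1 \<gamma> x = 0" "partial 2 \<gamma> x = 0" "partial 3 \<gamma> x = D3 c (proj34 x)" "partial 4 \<gamma> x = D4 c (proj34 x)"
    "partial 1 \<alpha>3 x = D3 b (proj34 x)" "partial 2 \<alpha>3 x = D3 c (proj34 x)"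
    "partial 1 \<alpha>4 x = D4 b (proj34 x)" "partial 2 \<alpha>4 x = D4 c (proj34 x)"
  unfolding \<alpha>_def \<alpha>3_def \<alpha>4_def \<beta>_def[abs_def] \<gamma>_def[abs_def]
  by (simp_all add: partial_fibre_affine partial_comp_proj34 diff_base[OF x] sm0)

private lemma christoffel_eq:
  assumes x: "x \<in> \<Omega>"
  shows "christoffel (walker_metric a) k i j x = walker_gamma (\<alpha> x) (\<beta> x) (\<gamma> x) (\<alpha>3 x) (\<alpha>4 x) k i j"
proof -
  have a\<alpha>: "a y = \<alpha> y" if "y \<in> \<Omega>" for y
    using a[OF that] by (simp add: \<alpha>_def fibre_affine_def proj34_def)
  show ?thesis
    by (simp add: christoffel_walker partial_cong_open[OF \<Omega> x a\<alpha>] a\<alpha>[OF x] partial_parts x)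
qed

private lemma smooth_christoffel: "smooth_on \<Omega> (christoffel (walker_metric a) k i j)"
proof -
  have "smooth_on \<Omega> (\<lambda>x. walker_gamma (\<alpha> x) (\<beta> x) (\<gamma> x) (\<alpha>3 x) (\<alpha>4 x) k i j)"
    unfolding walker_gamma_def
    by (intro smooth_on_if smooth_on_divide_const smooth_on_add smooth_on_diff smooth_on_mult
        smooth_on_minus smooth_on_const \<Omega> smooth_parts)
  then show ?thesis
    by (subst smooth_on_cong[OF \<Omega> christoffel_eq]) auto
qed

private lemma coord_ricci_eq:
  assumes x: "x \<in> \<Omega>"
  shows "coord_ricci (walker_metric a) j k x = walker_ricci b c j k (proj34 x)"
proof -
  note df = smooth_parts[THEN smooth_on_differentiable, OF x]
  have p: "partial m (christoffel (walker_metric a) k i j) x =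
      partial m (\<lambda>x. walker_gamma (\<alpha> x) (\<beta> x) (\<gamma> x) (\<alpha>3 x) (\<alpha>4 x) k i j) x" for m k i j
    by (rule partial_cong_open[OF \<Omega> x christoffel_eq])
  have z: "b (proj34 x) = \<beta> x" "c (proj34 x) = \<gamma> x" by (simp_all add: \<beta>_def \<gamma>_def)
  have "\<forall>j k. coord_ricci (walker_metric a) j k x = walker_ricci b c j k (proj34 x)"
    unfolding forall_4 coord_ricci_def coord_curvature_def p christoffel_eq[OF x] sum_4
    by (simp add: walker_gamma_def walker_ricci_def partial_add partial_diff partial_minus partial_divide_const
        partial_mult differentiable_add differentiable_mult differentiable_diff df partial_parts[OF x] z)
      (simp add: field_simps)
  then show ?thesis by blast
qed

private lemma coord_deriv_ricci_eq:
  assumes x: "x \<in> \<Omega>"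
  shows "coord_deriv_ricci (walker_metric a) i j k x = walker_deriv_ricci b c i j k (proj34 x)"
proof -
  define z where z: "z = proj34 x"
  note df = sm0[THEN diff_base[OF x], folded z]
  have p: "partial m (coord_ricci (walker_metric a) j k) x = partial m (\<lambda>x. walker_ricci b c j k (proj34 x)) x" for m j k
    by (rule partial_cong_open[OF \<Omega> x coord_ricci_eq])
  have sm: "smooth_on (proj34 ` \<Omega>) (walker_ricci b c j k)" for j k
    unfolding walker_ricci_def
    by (auto intro!: smooth_on_divide_const smooth_on_add smooth_on_diff smooth_on_mult smooth_on_const
        open_proj34_image \<Omega> sm0)
  have pd: "partial 1 (coord_ricci (walker_metric a) j k) x = 0" "partial 2 (coord_ricci (walker_metric a) j k) x = 0"
    "partial 3 (coord_ricci (walker_metric a) j k) x = D3 (walker_ricci b c j k) z"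
    "partial 4 (coord_ricci (walker_metric a) j k) x = D4 (walker_ricci b c j k) z" for j k
    unfolding p z by (rule partial_comp_proj34[OF diff_base[OF x sm]])+
  have zz: "\<beta> x = b z" "\<gamma> x = c z" by (simp_all add: \<beta>_def \<gamma>_def z)
  have comm: "D3 (D4 f) z = D4 (D3 f) z" if "smooth_on (proj34 ` \<Omega>) f" for f
    using x by (intro D3_D4_commute[OF open_proj34_image[OF \<Omega>] that]) (simp add: z)
  have "\<forall>i j k. coord_deriv_ricci (walker_metric a) i j k x = walker_deriv_ricci b c i j k z"
    unfolding forall_4 coord_deriv_ricci_def pd christoffel_eq[OF x] coord_ricci_eq[OF x, folded z] sum_4 zz
    by (simp add: walker_gamma_def walker_ricci_def walker_deriv_ricci_def D_diff D_add D_mult D_divide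
       D_const df comm b c differentiable_mult differentiable_add differentiable_diff)
      (simp add: field_simps)
  then show ?thesis by (simp add: z)
qed

lemma parallel_ricci_on_walker_iff:
  "parallel_ricci_on \<Omega> (walker_metric a) \<longleftrightarrow> coefficient_system b c (proj34 ` \<Omega>)"
  unfolding parallel_ricci_on_iff_coord[OF \<Omega> smooth_christoffel]
    coefficient_system_iff_walker_deriv_ricci
  by (simp add: coord_deriv_ricci_eq)

end

section \<open>Walker metrics with parallel Ricci tensor\<close>

lemma coefficient_system_Union:
  "coefficient_system b c (proj34 ` \<Union>\<C>) \<longleftrightarrow> (\<forall>W\<in>\<C>. coefficient_system b c (proj34 ` W))"
  by (simp only: coefficient_system_def image_Union ball_UN)

theorem theorem3p3:
  fixes \<Omega> :: "(real^4) set"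
    and a :: "real^4 \<Rightarrow> real"
    and b c d :: "real \<times> real \<Rightarrow> real"
  assumes "open \<Omega>"
    and "smooth_on (proj34 ` \<Omega>) b"
    and "smooth_on (proj34 ` \<Omega>) c"
    and "smooth_on (proj34 ` \<Omega>) d"
    and "\<And>x. x \<in> \<Omega> \<Longrightarrow>
      a x = x $ 1 * b (x $ 3, x $ 4) + x $ 2 * c (x $ 3, x $ 4) + d (x $ 3, x $ 4)"
  shows "(connected \<Omega> \<longrightarrow>
            (parallel_ricci_on \<Omega> (walker_metric a) \<longleftrightarrow> (\<exists>k l. parallel_system b c k l \<Omega>))) \<and>
         (parallel_ricci_on \<Omega> (walker_metric a) \<longleftrightarrow>
            (\<forall>W \<in> components \<Omega>. \<exists>k l. parallel_system b c k l W))"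
proof -
  have sys: "coefficient_system b c (proj34 ` W) \<longleftrightarrow> (\<exists>k l. parallel_system b c k l W)"
    if W: "W \<subseteq> \<Omega>" "open W" "connected W" for W
  proof -
    have sm: "smooth_on (proj34 ` W) b" "smooth_on (proj34 ` W) c"
      using assms(2,3) smooth_on_subset[OF _ image_mono[OF W(1)]] by blast+
    show ?thesis
      using parallel_system_imp_coefficient_system[OF open_proj34_image[OF W(2)] sm]
        coefficient_system_imp_parallel_system[OF open_proj34_image[OF W(2)]
          connected_proj34_image[OF W(3)] sm]
      by blast
  qed
  have par: "parallel_ricci_on \<Omega> (walker_metric a) \<longleftrightarrow> coefficient_system b c (proj34 ` \<Omega>)"
    using parallel_ricci_on_walker_iff[OF assms] by blast
  also have "\<dots> \<longleftrightarrow> (\<forall>W \<in> components \<Omega>. coefficient_system b c (proj34 ` W))"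
    using coefficient_system_Union[of b c "components \<Omega>"] Union_components[of \<Omega>] by simp
  also have "\<dots> \<longleftrightarrow> (\<forall>W \<in> components \<Omega>. \<exists>k l. parallel_system b c k l W)"
    using sys in_components_subset open_components[OF assms(1)] in_components_connected by (metis (no_types, lifting))
  finally show ?thesis
    using par sys[OF order_refl assms(1)] by blast
qed

end
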